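(* Let $\mathbb{G}$ be a stratified group with $N\geq3$ being the dimension of the first stratum. Then for all complex-valued functions $f\in C_{0}^{\infty}(\mathbb{G}\backslash\{x'=0\})$ we have $$\left\|\frac{x'\cdot\nabla_{H}f}{|x'|}\right\|_{L^{2}(\mathbb{G})}\geq \frac{N-2}{2}\left\|\frac{f}{|x'|}\right\|_{L^{2}(\mathbb{G})},$$ where the constant $\frac{N-2}{2}$ is sharp (that is, it cannot be replaced by any larger constant such that the inequality still holds for all such $f$).
   Context: A stratified group (homogeneous Carnot group) is a triple $\mathbb{G}=(\mathbb{R}^{n},\circ,D_{\lambda})$, where $(\mathbb{R}^n,\circ)$ is a Lie group with identity $0$, such that: (i) for some natural numbers $N=N_1,N_2,\ldots,N_r$ with $N+N_2+\cdots+N_r=n$ one has $\mathbb{R}^{n}=\mathbb{R}^{N}\times\mathbb{R}^{N_2}\times\cdots\times\mathbb{R}^{N_r}$ and, for each $\lambda>0$, the dilation $D_{\lambda}(x',x^{(2)},\ldots,x^{(r)})=(\lambda x',\lambda^{2}x^{(2)},\ldots,\lambda^{r}x^{(r)})$, with $x'\in\mathbb{R}^N$, $x^{(k)}\in\mathbb{R}^{N_k}$, is an automorphism of $\mathbb{G}$; (ii) if $X_1,\ldots,X_N$ are the left invariant vector fields on $\mathbb{G}$ with $X_k(0)=\frac{\partial}{\partial x_k}|_0$ for $k=1,\ldots,N$, then $\mathrm{rank}(\mathrm{Lie}\{X_1,\ldots,X_N\})=n$ at every $x\in\mathbb{R}^n$. $N$ is the dimension of the first stratum. Notation: $\nabla_H=(X_1,\ldots,X_N)$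 is the horizontal gradient; $|x'|=\sqrt{x_1'^2+\cdots+x_N'^2}$ is the Euclidean norm on $\mathbb{R}^N$; $x'\cdot\nabla_H f=\sum_{k=1}^N x'_kX_kf$. $L^2(\mathbb{G})$ is taken with respect to Haar measure, which is Lebesgue measure on $\mathbb{R}^n$. $C_0^\infty(\mathbb{G}\backslash\{x'=0\})$ denotes smooth functions compactly supported in $\{x\in\mathbb{G}:x'\neq0\}$. *)

theory Defs
  imports "HOL-Analysis.Analysis"
begin

section \<open>Smooth maps between Euclidean spaces\<close>

text \<open>
  \<open>C_diff k f\<close>: f is of class $C^k$ on the whole space. In the successor case all directional
  derivatives \<open>x \<mapsto> Df(x) v\<close> are required to be of class $C^{k}$; by finite dimension this says
  that \<open>x \<mapsto> Df(x)\<close> is.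
\<close>

primrec C_diff :: "nat \<Rightarrow> ('a::euclidean_space \<Rightarrow> 'b::euclidean_space) \<Rightarrow> bool" where
  "C_diff 0 f \<longleftrightarrow> continuous_on UNIV f"
| "C_diff (Suc k) f \<longleftrightarrow>
     (\<forall>x. f differentiable (at x)) \<and> (\<forall>v. C_diff k (\<lambda>x. frechet_derivative f (at x) v))"

definition smooth :: "('a::euclidean_space \<Rightarrow> 'b::euclidean_space) \<Rightarrow> bool" where
  "smooth f \<longleftrightarrow> (\<forall>k. C_diff k f)"


section \<open>Vector fields\<close>

text \<open>A vector field on $\mathbb{R}^n$ is given by its coefficient map.\<close>

definition vf_apply ::
  "('a::euclidean_space \<Rightarrow> 'a) \<Rightarrow> ('a \<Rightarrow> 'b::euclidean_space) \<Rightarrow> 'a \<Rightarrow> 'b" where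
  "vf_apply Z f x = frechet_derivative f (at x) (Z x)"

text \<open>Coefficient map of the commutator \<open>f \<mapsto> Y (Z f) - Z (Y f)\<close>.\<close>

definition lie_bracket ::
  "('a::euclidean_space \<Rightarrow> 'a) \<Rightarrow> ('a \<Rightarrow> 'a) \<Rightarrow> 'a \<Rightarrow> 'a" where
  "lie_bracket Y Z x = vf_apply Y Z x - vf_apply Z Y x"

inductive_set lie_generated ::
  "('a::euclidean_space \<Rightarrow> 'a) set \<Rightarrow> ('a \<Rightarrow> 'a) set"
  for S :: "('a \<Rightarrow> 'a) set" where
  generator: "Z \<in> S \<Longrightarrow> Z \<in> lie_generated S"
| zero: "(\<lambda>x. 0) \<in> lie_generated S"
| add: "Y \<in> lie_generated S \<Longrightarrow> Z \<in> lie_generated S \<Longrightarrow> (\<lambda>x. Y x + Z x) \<in> lie_generated S"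
| scale: "Z \<in> lie_generated S \<Longrightarrow> (\<lambda>x. c *\<^sub>R Z x) \<in> lie_generated S"
| bracket: "Y \<in> lie_generated S \<Longrightarrow> Z \<in> lie_generated S \<Longrightarrow> lie_bracket Y Z \<in> lie_generated S"

definition rank_at :: "('a::euclidean_space \<Rightarrow> 'a) set \<Rightarrow> 'a \<Rightarrow> nat" where
  "rank_at L x = dim ((\<lambda>Z. Z x) ` L)"


section \<open>Stratified groups\<close>

text \<open>Lie group structures on $\mathbb{R}^n$ with its standard manifold structure and identity 0.\<close>

definition lie_group :: "('a::euclidean_space \<Rightarrow> 'a \<Rightarrow> 'a) \<Rightarrow> bool" where
  "lie_group mul \<longleftrightarrow>
     (\<exists>ginv. group mul 0 ginv \<and> smooth (\<lambda>(x, y). mul x y) \<and> smooth ginv)"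

definition lie_group_automorphism ::
  "('a::euclidean_space \<Rightarrow> 'a \<Rightarrow> 'a) \<Rightarrow> ('a \<Rightarrow> 'a) \<Rightarrow> bool" where
  "lie_group_automorphism mul \<phi> \<longleftrightarrow>
     bij \<phi> \<and> smooth \<phi> \<and> smooth (inv \<phi>) \<and> (\<forall>x y. \<phi> (mul x y) = mul (\<phi> x) (\<phi> y))"

definition left_invariant ::
  "('a::euclidean_space \<Rightarrow> 'a \<Rightarrow> 'a) \<Rightarrow> ('a \<Rightarrow> 'a) \<Rightarrow> bool" where
  "left_invariant mul Z \<longleftrightarrow>
     smooth Z \<and> (\<forall>x y. frechet_derivative (mul x) (at y) (Z y) = Z (mul x y))"

text \<open>
  The splitting $\mathbb{R}^n = \mathbb{R}^{N} \times \mathbb{R}^{N_2} \times \dots \times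
  \mathbb{R}^{N_r}$ is encoded by the function \<open>w\<close> assigning to each coordinate the number of the
  factor it belongs to, so that $N_k$ is the cardinality of \<open>stratum w k\<close>. As the coordinates are
  indexed by an arbitrary finite type, no ordering of them is prescribed.
\<close>

definition stratum :: "('n::finite \<Rightarrow> nat) \<Rightarrow> nat \<Rightarrow> 'n set" where
  "stratum w k = {i. w i = k}"

definition dilation :: "('n::finite \<Rightarrow> nat) \<Rightarrow> real \<Rightarrow> real ^ 'n \<Rightarrow> real ^ 'n" where
  "dilation w r x = (\<chi> i. r ^ w i * x $ i)"

text \<open>
  \<open>X k\<close>, for k in the first stratum, is the left invariant vector field with
  $X_k(0) = \partial/\partial x_k$; the other values of \<open>X\<close> are irrelevant.
\<close>

definition horizontal_frame ::
  "(real ^ 'n \<Rightarrow> real ^ 'n \<Rightarrow> real ^ 'n) \<Rightarrow> ('n::finite \<Rightarrow> nat) \<Rightarrow>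
   ('n \<Rightarrow> real ^ 'n \<Rightarrow> real ^ 'n) \<Rightarrow> bool" where
  "horizontal_frame mul w X \<longleftrightarrow>
     (\<forall>k \<in> stratum w 1. left_invariant mul (X k) \<and> X k 0 = axis k 1)"

text \<open>
  In a Lie group the vector fields of a horizontal frame exist and are unique, so the quantifier
  over \<open>X\<close> in the rank condition refers to exactly one family of vector fields.
\<close>

definition stratified_group ::
  "(real ^ 'n \<Rightarrow> real ^ 'n \<Rightarrow> real ^ 'n) \<Rightarrow> ('n::finite \<Rightarrow> nat) \<Rightarrow> bool" where
  "stratified_group mul w \<longleftrightarrow>
     lie_group mul \<and>
     (\<forall>i. 1 \<le> w i) \<and>
     (\<forall>r>0. lie_group_automorphism mul (dilation w r)) \<and>
     (\<forall>X. horizontal_frame mul w X \<longrightarrow>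
        (\<forall>x. rank_at (lie_generated (X ` stratum w 1)) x = CARD('n)))"


section \<open>Function spaces and norms\<close>

definition horizontal_norm :: "('n::finite \<Rightarrow> nat) \<Rightarrow> real ^ 'n \<Rightarrow> real" where
  "horizontal_norm w x = sqrt (\<Sum>k\<in>stratum w 1. (x $ k)\<^sup>2)"

definition horizontal_radial ::
  "('n::finite \<Rightarrow> nat) \<Rightarrow> ('n \<Rightarrow> real ^ 'n \<Rightarrow> real ^ 'n) \<Rightarrow>
   (real ^ 'n \<Rightarrow> complex) \<Rightarrow> real ^ 'n \<Rightarrow> complex" where
  "horizontal_radial w X f x = (\<Sum>k\<in>stratum w 1. of_real (x $ k) * vf_apply (X k) f x)"

text \<open>
  $C_0^\infty(\mathbb{G} \setminus \{x' = 0\})$, its elements being extended by zero to all of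
  $\mathbb{R}^n$.
\<close>

definition test_functions :: "('n::finite \<Rightarrow> nat) \<Rightarrow> (real ^ 'n \<Rightarrow> complex) set" where
  "test_functions w =
     {f. smooth f \<and> compact (closure {x. f x \<noteq> 0}) \<and>
         closure {x. f x \<noteq> 0} \<subseteq> {x. \<exists>k \<in> stratum w 1. x $ k \<noteq> 0}}"

text \<open>
  Haar measure is Lebesgue measure. The norm is only used for continuous functions with compact
  support, for which the integral is finite.
\<close>

definition L2_norm :: "(real ^ 'n::finite \<Rightarrow> complex) \<Rightarrow> real" where
  "L2_norm g = sqrt (LINT x|lborel. (cmod (g x))\<^sup>2)"

end

theory Submission
  imports Defs
begin

text \<open>
  Write $S$ for the first stratum, $s(x) = |x'|^2$, $c = (N-2)/2$ and
  $Z = \sum_{k \in S} x_k X_k$, so that $x' \cdot \nabla_H f = Z f$.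

  Two facts about the group enter. Since dilations are automorphisms, the \<open>j\<close>-th coefficient of
  $X_k$ is homogeneous of degree \<open>w j - 1\<close> (\<open>frame_homogeneous\<close>). A continuous function of degree
  0 is constant, so $X_k$ agrees with $\partial_k$ in the first stratum and
  $Z$ has first-stratum components $x'$. A continuous function of degree $-1$ vanishes, so the
  \<open>j\<close>-th coefficient of $X_k$ does not depend on $x_j$, and hence $\mathrm{div}\, Z = N$.

  The inequality is the following completed square. For a test function \<open>f\<close>, the divergence of
  $(|f|^2/s) Z$ integrates to zero, and expanding it gives
  \[ \int \frac{|Zf|^2}{s} = c^2 \int \frac{|f|^2}{s} + \int \frac{|Zf + c f|^2}{s} \]
  (\<open>hardy_identity\<close>). The last term is the exact defect in Hardy's inequality, so sharpness means
  that it can be made small compared with $\int |f|^2/s$.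

  For this the strata above the first are stretched by a factor that tends to infinity. By
  homogeneity this turns $Z$, in the limit, into the Euler field $E = \sum_{k \in S} x_k \partial_k$
  of the first stratum, so that a constant valid on the group is valid for $E$ as well
  (\<open>blow_up_inequality\<close>). There the defect vanishes on functions that equal $|x'|^{-c}$ times
  a function of the remaining coordinates, which just fail to be admissible. Cut off at the
  scales $|x'|^2 = 1$ and $|x'|^2 = 64^m$, as a function of $|x'|^{2/m}$, they have a
  defect of order $1/m^2$ relative to $\int |f|^2/s$. Both integrals are compared by counting
  annuli: the weight $|x'|^{-N}$ gives the same mass to all annuli $4^j \le |x'|^2 < 4^{j+1}$.
\<close>

section \<open>Functions of class $C^k$ on open sets\<close>

text \<open>
  The local version of \<open>C_diff\<close>: the test functions built below are products and composites
  of functions such as powers, which are smooth only away from the origin.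
\<close>

primrec C_diff_on :: "nat \<Rightarrow> 'a::euclidean_space set \<Rightarrow> ('a \<Rightarrow> 'b::euclidean_space) \<Rightarrow> bool" where
  "C_diff_on 0 U f \<longleftrightarrow> continuous_on U f"
| "C_diff_on (Suc k) U f \<longleftrightarrow>
     (\<forall>x\<in>U. f differentiable (at x)) \<and> (\<forall>v. C_diff_on k U (\<lambda>x. frechet_derivative f (at x) v))"

lemma C_diff_iff_C_diff_on_UNIV: "C_diff k f \<longleftrightarrow> C_diff_on k UNIV f"
  by (induction k arbitrary: f) auto

text \<open>
  On an open set, agreement of two functions is inherited by their derivatives.
\<close>

lemma C_diff_on_cong:
  assumes "open U" "\<And>x. x \<in> U \<Longrightarrow> f x = g x"
  shows "C_diff_on k U f \<longleftrightarrow> C_diff_on k U g"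
  using assms(2)
proof (induction k arbitrary: f g)
  case 0
  then show ?case by (auto intro: continuous_on_cong)
next
  case (Suc k)
  have der: "(f has_derivative D) (at x) \<longleftrightarrow> (g has_derivative D) (at x)" if "x \<in> U" for x D
    using has_derivative_transform_within_open[OF _ \<open>open U\<close> that] Suc.prems by metis
  have "frechet_derivative f (at x) = frechet_derivative g (at x)" if "x \<in> U" for x
    unfolding frechet_derivative_def using der[OF that] by simp
  then have "C_diff_on k U (\<lambda>x. frechet_derivative f (at x) v) \<longleftrightarrow>
      C_diff_on k U (\<lambda>x. frechet_derivative g (at x) v)" for v
    by (intro Suc.IH) auto
  with der show ?case
    by (auto simp: differentiable_def)
qed

text \<open>
  Replaces the chosen derivative by any explicitly computed one; the closure properties
  below rest on this rule.
\<close>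

lemma C_diff_on_SucI:
  assumes "open U" "\<And>x. x \<in> U \<Longrightarrow> (f has_derivative f' x) (at x)"
    and "\<And>v. C_diff_on k U (\<lambda>x. f' x v)"
  shows "C_diff_on (Suc k) U f"
proof -
  have "frechet_derivative f (at x) = f' x" if "x \<in> U" for x
    by (rule frechet_derivative_at[OF assms(2)[OF that], symmetric])
  then have "C_diff_on k U (\<lambda>x. frechet_derivative f (at x) v)" for v
    using assms(3)[of v] by (subst C_diff_on_cong[OF assms(1), where g = "\<lambda>x. f' x v"]) simp_all
  then show ?thesis
    using assms(2) by (auto simp: differentiable_def)
qed

lemma C_diff_on_SucD_has_derivative:
  assumes "C_diff_on (Suc k) U f" "x \<in> U"
  shows "(f has_derivative frechet_derivative f (at x)) (at x)"
  using assms by (simp add: frechet_derivative_works)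

lemma C_diff_on_lower: "C_diff_on (Suc k) U f \<Longrightarrow> C_diff_on k U f"
proof (induction k arbitrary: f)
  case 0
  then show ?case
    by (auto intro!: continuous_at_imp_continuous_on differentiable_imp_continuous_within)
next
  case (Suc k)
  then show ?case by (metis C_diff_on.simps(2))
qed

lemma C_diff_on_subset: "C_diff_on k U f \<Longrightarrow> V \<subseteq> U \<Longrightarrow> C_diff_on k V f"
  by (induction k arbitrary: f) (auto intro: continuous_on_subset)

text \<open>
  Used to glue a function that is smooth where $x' \neq 0$ to the zero function near
  $x' = 0$.
\<close>

lemma C_diff_on_Un:
  "open U \<Longrightarrow> open V \<Longrightarrow> C_diff_on k U f \<Longrightarrow> C_diff_on k V f \<Longrightarrow> C_diff_on k (U \<union> V) f"
  by (induction k arbitrary: f) (auto intro: continuous_on_open_Un)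

lemma C_diff_on_const: "open U \<Longrightarrow> C_diff_on k U (\<lambda>x. c)"
proof (induction k arbitrary: c)
  case (Suc k)
  then show ?case by (intro C_diff_on_SucI[where f' = "\<lambda>x v. 0"]) auto
qed simp

lemma C_diff_on_linear_compose:
  assumes "open U" "bounded_linear L" "C_diff_on k U f"
  shows "C_diff_on k U (\<lambda>x. L (f x))"
  using assms(3)
proof (induction k arbitrary: f)
  case 0
  then show ?case using bounded_linear.continuous_on[OF assms(2)] by simp
next
  case (Suc k)
  show ?case
  proof (rule C_diff_on_SucI[OF assms(1)])
    show "((\<lambda>x. L (f x)) has_derivative (\<lambda>v. L (frechet_derivative f (at x) v))) (at x)"
      if "x \<in> U" for x
      using bounded_linear.has_derivative[OF assms(2) C_diff_on_SucD_has_derivative[OF Suc.prems that]] .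
    show "C_diff_on k U (\<lambda>x. L (frechet_derivative f (at x) v))" for v
      using Suc by simp
  qed
qed

lemma C_diff_on_linear:
  assumes "open U" "bounded_linear L"
  shows "C_diff_on k U L"
proof (cases k)
  case 0
  then show ?thesis using assms(2) by (simp add: linear_continuous_on)
next
  case (Suc j)
  show ?thesis unfolding Suc
    by (rule C_diff_on_SucI[where f' = "\<lambda>x. L", OF assms(1)])
      (auto simp: bounded_linear_imp_has_derivative assms C_diff_on_const)
qed

lemma C_diff_on_add:
  assumes "open U" "C_diff_on k U f" "C_diff_on k U g"
  shows "C_diff_on k U (\<lambda>x. f x + g x)"
  using assms(2,3)
proof (induction k arbitrary: f g)
  case 0
  then show ?case by (simp add: continuous_on_add)
next
  case (Suc k)
  show ?case
  proof (rule C_diff_on_SucI[OF assms(1)])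
    show "((\<lambda>x. f x + g x) has_derivative
        (\<lambda>v. frechet_derivative f (at x) v + frechet_derivative g (at x) v)) (at x)"
      if "x \<in> U" for x
      using that Suc.prems by (intro has_derivative_add C_diff_on_SucD_has_derivative)
    show "C_diff_on k U (\<lambda>x. frechet_derivative f (at x) v + frechet_derivative g (at x) v)" for v
      using Suc by simp
  qed
qed

text \<open>
  The derivative of a product is a sum of products of functions of class $C^k$, where the factors
  that are not differentiated are in class $C^k$ by \<open>C_diff_on_lower\<close>.
\<close>

lemma C_diff_on_mult:
  fixes f g :: "'a::euclidean_space \<Rightarrow> real"
  assumes "open U" "C_diff_on k U f" "C_diff_on k U g"
  shows "C_diff_on k U (\<lambda>x. f x * g x)"
  using assms(2,3)
proof (induction k arbitrary: f g)
  case 0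
  then show ?case by (simp add: continuous_on_mult)
next
  case (Suc k)
  note lower = Suc.prems[THEN C_diff_on_lower]
  show ?case
  proof (rule C_diff_on_SucI[OF assms(1)])
    show "((\<lambda>x. f x * g x) has_derivative
        (\<lambda>v. f x * frechet_derivative g (at x) v + frechet_derivative f (at x) v * g x)) (at x)"
      if "x \<in> U" for x
      using that Suc.prems by (intro has_derivative_mult C_diff_on_SucD_has_derivative)
    show "C_diff_on k U (\<lambda>x. f x * frechet_derivative g (at x) v + frechet_derivative f (at x) v * g x)" for v
      using Suc lower by (intro C_diff_on_add[OF assms(1)] Suc.IH) auto
  qed
qed

lemma C_diff_on_sum:
  assumes "open U" "\<And>i. i \<in> I \<Longrightarrow> C_diff_on k U (f i)"
  shows "C_diff_on k U (\<lambda>x. \<Sum>i\<in>I. f i x)"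
  using assms(2)
  by (induction I rule: infinite_finite_induct)
    (auto intro: C_diff_on_const C_diff_on_add assms(1))

text \<open>
  A scalar outer function suffices here, and makes the chain rule a product, so that the
  induction needs only \<open>C_diff_on_mult\<close>.
\<close>

lemma C_diff_on_compose_real:
  fixes g :: "'a::euclidean_space \<Rightarrow> real" and h :: "real \<Rightarrow> real"
  assumes "open U" "open V" "g ` U \<subseteq> V" "C_diff_on k U g" "C_diff_on k V h"
  shows "C_diff_on k U (\<lambda>x. h (g x))"
  using assms(4,5)
proof (induction k arbitrary: h)
  case 0
  then show ?case using assms(3) by (auto intro: continuous_on_compose2)
next
  case (Suc k)
  let ?h' = "\<lambda>y. frechet_derivative h (at y) 1"
  show ?case
  proof (rule C_diff_on_SucI[OF assms(1)])
    show "((\<lambda>x. h (g x)) has_derivative (\<lambda>v. ?h' (g x) * frechet_derivative g (at x) v)) (at x)"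
      if "x \<in> U" for x
    proof -
      have "(h has_derivative frechet_derivative h (at (g x))) (at (g x))"
        using Suc.prems(2) assms(3) that by (auto simp: frechet_derivative_works[symmetric])
      then have "((\<lambda>x. h (g x)) has_derivative
          (\<lambda>v. frechet_derivative h (at (g x)) (frechet_derivative g (at x) v))) (at x)"
        using has_derivative_compose[OF C_diff_on_SucD_has_derivative[OF Suc.prems(1) that]] by blast
      moreover have "linear (frechet_derivative h (at (g x)))"
        using \<open>(h has_derivative _) _\<close> has_derivative_linear by blast
      then have "frechet_derivative h (at (g x)) r = ?h' (g x) * r" for r
        using linear_cmul[of "frechet_derivative h (at (g x))" r 1] by (simp add: mult.commute)
      then have "(\<lambda>v. frechet_derivative h (at (g x)) (frechet_derivative g (at x) v)) =
          (\<lambda>v. ?h' (g x) * frechet_derivative g (at x) v)"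
        by (rule ext)
      ultimately show ?thesis by metis
    qed
    have "C_diff_on k U (\<lambda>x. ?h' (g x))"
      using Suc.IH[OF C_diff_on_lower[OF Suc.prems(1)], of ?h'] Suc.prems(2) by simp
    then show "C_diff_on k U (\<lambda>x. ?h' (g x) * frechet_derivative g (at x) v)" for v
      using Suc.prems(1) by (simp add: C_diff_on_mult[OF assms(1)])
  qed
qed

lemma C_diff_on_powr: "C_diff_on k {0<..} (\<lambda>x::real. x powr a)"
proof (induction k arbitrary: a)
  case 0
  then show ?case by (auto intro!: continuous_intros)
next
  case (Suc k)
  show ?case
  proof (rule C_diff_on_SucI)
    show "((\<lambda>x. x powr a) has_derivative (\<lambda>v. a * x powr (a - 1) * v)) (at x)"
      if "x \<in> {0<..}" for x
      using has_real_derivative_powr[of x a] that by (simp add: has_field_derivative_def mult_commute_abs)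
    show "C_diff_on k {0<..} (\<lambda>x. a * x powr (a - 1) * v)" for v
      using Suc by (intro C_diff_on_mult C_diff_on_const) auto
  qed simp
qed

text \<open>
  The functions $e^{-1/x} x^{-n}$ on the positive half line. The family is closed under
  differentiation up to linear combinations, which proves smoothness of the classical flat function
  \<open>flat 0\<close> by a single induction.
\<close>

definition flat :: "nat \<Rightarrow> real \<Rightarrow> real" where
  "flat n x = (if x > 0 then exp (- 1 / x) / x ^ n else 0)"

text \<open>
  Substituting $x = 1/t$, the exponential beats every power.
\<close>

lemma flat_tendsto_0: "(flat n \<longlongrightarrow> 0) (at 0)"
proof -
  have "((\<lambda>x. inverse x ^ n / exp (inverse x)) \<longlongrightarrow> 0) (at_right (0::real))"
    by (rule filterlim_compose[OF tendsto_power_div_exp_0 filterlim_inverse_at_top_right])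
  moreover have "\<forall>\<^sub>F x in at_right (0::real). inverse x ^ n / exp (inverse x) = flat n x"
    unfolding eventually_at_right_field
    by (intro exI[of _ 1]) (auto simp: flat_def exp_minus field_simps)
  ultimately have "(flat n \<longlongrightarrow> 0) (at_right 0)"
    by (rule Lim_transform_eventually)
  moreover have "(flat n \<longlongrightarrow> 0) (at_left 0)"
    by (rule tendsto_eventually) (auto simp: eventually_at_left_field flat_def intro!: exI[of _ "-1"])
  ultimately show ?thesis by (simp add: filterlim_split_at)
qed

text \<open>
  At the origin the difference quotient of \<open>flat n\<close> is \<open>flat (n + 1)\<close>.
\<close>

lemma flat_has_derivative:
  "(flat n has_real_derivative (flat (n + 2) x - n * flat (n + 1) x)) (at x)"
proof (cases x "0::real" rule: linorder_cases)
  case less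
  have "(flat n has_real_derivative 0) (at x)"
    by (rule has_field_derivative_transform_within_open[where S = "{..<0}" and f = "\<lambda>_. 0"])
      (use less in \<open>auto simp: flat_def\<close>)
  then show ?thesis using less by (simp add: flat_def)
next
  case equal
  have "((\<lambda>h. (flat n (0 + h) - flat n 0) / h) \<longlongrightarrow> 0) (at 0)"
  proof -
    have "(\<lambda>h. (flat n (0 + h) - flat n 0) / h) = flat (Suc n)"
      by (auto simp: flat_def fun_eq_iff)
    then show ?thesis using flat_tendsto_0 by metis
  qed
  then have "(flat n has_real_derivative 0) (at 0)" by (simp add: DERIV_def)
  then show ?thesis using equal by (simp add: flat_def)
next
  case greater
  have pow: "x * x ^ (m - Suc 0) = x ^ m" if "m \<noteq> 0" for m
    using that by (cases m) auto
  have "((\<lambda>x. exp (- 1 / x) / x ^ n) has_real_derivative (flat (n + 2) x - n * flat (n + 1) x)) (at x)"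
    using greater
    by (cases n; auto intro!: derivative_eq_intros simp: flat_def field_simps power2_eq_square; metis pow)
  then show ?thesis
    by (rule has_field_derivative_transform_within_open[where S = "{0<..}"])
      (use greater in \<open>auto simp: flat_def\<close>)
qed

lemma C_diff_on_flat: "C_diff_on k UNIV (flat n)"
proof (induction k arbitrary: n)
  case 0
  then show ?case
    using flat_has_derivative by (auto intro!: continuous_at_imp_continuous_on DERIV_isCont)
next
  case (Suc k)
  show ?case
  proof (rule C_diff_on_SucI)
    show "(flat n has_derivative (\<lambda>v. (flat (n + 2) x + (- n) * flat (n + 1) x) * v)) (at x)" for x
      using flat_has_derivative[of n x] by (simp add: has_field_derivative_def)
    show "C_diff_on k UNIV (\<lambda>x. (flat (n + 2) x + (- n) * flat (n + 1) x) * v)" for v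
      using Suc by (intro C_diff_on_mult C_diff_on_add C_diff_on_const) auto
  qed simp
qed


section \<open>The divergence theorem for compactly supported fields\<close>

lemma integrable_of_compact_support:
  fixes g :: "'a::euclidean_space \<Rightarrow> real"
  assumes "compact K" "continuous_on K g" "\<And>x. x \<notin> K \<Longrightarrow> g x = 0"
  shows "integrable lborel g"
proof -
  have "(\<lambda>x. indicator K x *\<^sub>R g x) = g"
    using assms(3) by (auto simp: indicator_def fun_eq_iff)
  then show ?thesis using borel_integrable_compact[OF assms(1,2)] by simp
qed

lemma has_derivative_zero_off_closed:
  assumes "closed K" "\<And>x. x \<notin> K \<Longrightarrow> g x = 0" "x \<notin> K"
  shows "(g has_derivative (\<lambda>v. 0)) (at x)"
  by (rule has_derivative_transform_within_open[of "\<lambda>_. 0" "\<lambda>v. 0" x UNIV "- K"])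
    (use assms in auto)

lemma integral_shift:
  fixes g :: "'a::euclidean_space \<Rightarrow> real"
  assumes "integrable lborel g"
  shows "integrable lborel (\<lambda>x. g (c + x))" and "(LINT x|lborel. g (c + x)) = (LINT x|lborel. g x)"
proof -
  have eq: "distr lborel borel ((+) c) = (lborel :: 'a measure)"
    by (rule lborel_distr_plus)
  show "integrable lborel (\<lambda>x. g (c + x))"
    using assms integrable_distr_eq[of "(+) c" lborel borel g] by (auto simp: eq)
  show "(LINT x|lborel. g (c + x)) = (LINT x|lborel. g x)"
    using assms integral_distr[of "(+) c" lborel borel g] by (auto simp: eq)
qed

text \<open>
  By translation invariance the difference quotients of \<open>g\<close> in direction \<open>v\<close> have integral zero.
  They are bounded by the supremum of the derivative and, for steps $tv$ with $0 \le t \le 1$, live on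
  a common compact set, so the integral passes to their limit.
\<close>

lemma integral_directional_derivative_eq_0:
  fixes g :: "'a::euclidean_space \<Rightarrow> real"
  assumes K: "compact K" "\<And>x. x \<notin> K \<Longrightarrow> g x = 0"
    and der: "\<And>x. (g has_derivative g' x) (at x)"
    and cont: "continuous_on K (\<lambda>x. g' x v)"
  shows "(LINT x|lborel. g' x v) = 0"
proof -
  have zero: "g' x v = 0" if "x \<notin> K" for x
  proof -
    have "g' x = (\<lambda>v. 0)"
      by (rule has_derivative_unique[OF der has_derivative_zero_off_closed])
        (use K that compact_imp_closed in auto)
    then show ?thesis by simp
  qed
  have "bounded ((\<lambda>x. g' x v) ` K)"
    using K(1) cont by (intro compact_imp_bounded compact_continuous_image)
  then obtain M0 where M0: "\<And>x. x \<in> K \<Longrightarrow> \<bar>g' x v\<bar> \<le> M0"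
    unfolding bounded_iff by auto
  define M where "M = max M0 0"
  have M: "\<bar>g' x v\<bar> \<le> M" for x
    using M0[of x] zero[of x] by (cases "x \<in> K") (auto simp: M_def)
  \<comment> \<open>contains all points from which a step $tv$ with $0 \le t \le 1$ leads into \<open>K\<close>\<close>
  define K' where "K' = (\<lambda>(x, t). x - t *\<^sub>R v) ` (K \<times> {0..1::real})"
  have "compact K'"
    unfolding K'_def using K(1)
    by (intro compact_continuous_image compact_Times)
      (auto intro!: continuous_intros simp: case_prod_unfold)
  have outside: "x + t *\<^sub>R v \<notin> K" if "x \<notin> K'" "0 \<le> t" "t \<le> 1" for x t
  proof
    assume "x + t *\<^sub>R v \<in> K"
    then have "(\<lambda>(x, t). x - t *\<^sub>R v) (x + t *\<^sub>R v, t) \<in> K'"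
      unfolding K'_def using that by (intro imageI) auto
    then show False using that by simp
  qed
  have gcont: "continuous_on A g" for A
    using der by (meson continuous_at_imp_continuous_on has_derivative_continuous)
  have gint: "integrable lborel g"
    by (rule integrable_of_compact_support[OF K(1) gcont K(2)])
  have line: "((\<lambda>t. g (x + t *\<^sub>R v)) has_real_derivative g' (x + t *\<^sub>R v) v) (at t)" for x t
  proof -
    have "((\<lambda>t. x + t *\<^sub>R v) has_derivative (\<lambda>r. r *\<^sub>R v)) (at t)"
      by (auto intro!: derivative_eq_intros)
    from has_derivative_compose[OF this der]
    have "((\<lambda>t. g (x + t *\<^sub>R v)) has_derivative (\<lambda>r. g' (x + t *\<^sub>R v) (r *\<^sub>R v))) (at t)" .
    moreover have "g' (x + t *\<^sub>R v) (r *\<^sub>R v) = g' (x + t *\<^sub>R v) v * r" for r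
      using linear_cmul[OF has_derivative_linear[OF der]] by simp
    ultimately show ?thesis by (simp add: has_field_derivative_def)
  qed
  define \<epsilon> where "\<epsilon> n = inverse (real (Suc n))" for n
  have \<epsilon>: "0 < \<epsilon> n" "\<epsilon> n \<le> 1" "\<epsilon> \<longlonglongrightarrow> 0" for n
    using LIMSEQ_inverse_real_of_nat by (auto simp: \<epsilon>_def[abs_def] field_simps)
  let ?q = "\<lambda>n x. (g (\<epsilon> n *\<^sub>R v + x) - g x) / \<epsilon> n"
  have q_int: "(LINT x|lborel. ?q n x) = 0" for n
    using integral_shift[OF gint, of "\<epsilon> n *\<^sub>R v"] gint by simp
  have "(\<lambda>n. LINT x|lborel. ?q n x) \<longlonglongrightarrow> (LINT x|lborel. g' x v)"
  proof (rule integral_dominated_convergence[where w = "\<lambda>x. indicator K' x *\<^sub>R M"])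
    show "(\<lambda>x. g' x v) \<in> borel_measurable lborel"
      using integrable_of_compact_support[OF K(1) cont zero] by auto
    show "(\<lambda>x. ?q n x) \<in> borel_measurable lborel" for n
      using integral_shift[OF gint, of "\<epsilon> n *\<^sub>R v"] gint by auto
    show "integrable lborel (\<lambda>x. indicator K' x *\<^sub>R M)"
      using \<open>compact K'\<close> by (intro borel_integrable_compact) auto
    show "AE x in lborel. (\<lambda>n. ?q n x) \<longlonglongrightarrow> g' x v"
    proof (rule AE_I2)
      fix x
      have "((\<lambda>h. (g (x + (0 + h) *\<^sub>R v) - g (x + 0 *\<^sub>R v)) / h) \<longlongrightarrow> g' x v) (at 0)"
        using line[of x 0] unfolding DERIV_def by simp
      moreover have "filterlim \<epsilon> (at 0) sequentially"
        using \<epsilon> by (intro filterlim_atI) (auto simp: less_imp_neq[symmetric])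
      ultimately show "(\<lambda>n. ?q n x) \<longlonglongrightarrow> g' x v"
        using filterlim_compose by (fastforce simp: add.commute)
    qed
    show "AE x in lborel. norm (?q n x) \<le> indicator K' x *\<^sub>R M" for n
    proof (rule AE_I2)
      fix x
      show "norm (?q n x) \<le> indicator K' x *\<^sub>R M"
      proof (cases "x \<in> K'")
        case True
        obtain z where "g (x + \<epsilon> n *\<^sub>R v) - g (x + 0 *\<^sub>R v) = (\<epsilon> n - 0) * g' (x + z *\<^sub>R v) v"
          using MVT2[of 0 "\<epsilon> n" "\<lambda>t. g (x + t *\<^sub>R v)" "\<lambda>t. g' (x + t *\<^sub>R v) v"] line \<epsilon>(1)
          by blast
        then have "?q n x = g' (x + z *\<^sub>R v) v"
          using \<epsilon>(1)[of n] by (simp add: add.commute)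
        then show ?thesis using M True by simp
      next
        case False
        then have "g (x + \<epsilon> n *\<^sub>R v) = 0" "g (x + 0 *\<^sub>R v) = 0"
          using outside[of x "\<epsilon> n"] outside[of x 0] K(2) \<epsilon>(1,2)[of n] by auto
        then show ?thesis using False by (simp add: add.commute)
      qed
    qed
  qed
  then have "(\<lambda>n. 0) \<longlonglongrightarrow> (LINT x|lborel. g' x v)"
    by (simp only: q_int)
  then show ?thesis by (simp add: LIMSEQ_const_iff)
qed

text \<open>
  The integrand is $\mathrm{div}(h Z)$, the sum of the partial derivatives of the components of
  \<open>h Z\<close>.
\<close>

lemma integral_divergence_eq_0:
  fixes h :: "real ^ 'n::finite \<Rightarrow> real" and Z :: "real ^ 'n \<Rightarrow> real ^ 'n"
  assumes K: "compact K" "\<And>x. x \<notin> K \<Longrightarrow> h x = 0"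
    and h': "\<And>x. (h has_derivative h' x) (at x)" "\<And>v. continuous_on K (\<lambda>x. h' x v)"
    and Z': "\<And>x. (Z has_derivative Z' x) (at x)" "\<And>v. continuous_on UNIV (\<lambda>x. Z' x v)"
  shows "(LINT x|lborel. h x * (\<Sum>i\<in>UNIV. Z' x (axis i 1) $ i) + h' x (Z x)) = 0"
    and "integrable lborel (\<lambda>x. h x * (\<Sum>i\<in>UNIV. Z' x (axis i 1) $ i) + h' x (Z x))"
proof -
  let ?g' = "\<lambda>i x v. h x * (Z' x v $ i) + h' x v * (Z x $ i)"
  have h'0: "h' x v = 0" if "x \<notin> K" for x v
  proof -
    have "h' x = (\<lambda>v. 0)"
      by (rule has_derivative_unique[OF h'(1) has_derivative_zero_off_closed])
        (use K that compact_imp_closed in auto)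
    then show ?thesis by simp
  qed
  have hcont: "continuous_on K h"
    using h'(1) by (meson continuous_at_imp_continuous_on has_derivative_continuous)
  have Zcont: "continuous_on K Z"
    using Z'(1) by (meson continuous_at_imp_continuous_on has_derivative_continuous)
  have Z'cont: "continuous_on K (\<lambda>x. Z' x v)" for v
    using Z'(2) continuous_on_subset by blast
  have der: "((\<lambda>x. h x * Z x $ i) has_derivative ?g' i x) (at x)" for i x
    by (intro has_derivative_mult h'(1) bounded_linear.has_derivative[OF bounded_linear_vec_nth Z'(1)])
  have cont: "continuous_on K (\<lambda>x. ?g' i x v)" for i v
    by (intro continuous_intros hcont Zcont Z'cont h'(2))
  have int: "integrable lborel (\<lambda>x. ?g' i x v)" for i v
    by (rule integrable_of_compact_support[OF K(1) cont]) (simp add: K(2) h'0)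
  have zero: "(LINT x|lborel. ?g' i x (axis i 1)) = 0" for i
    by (rule integral_directional_derivative_eq_0[OF K(1) _ der cont]) (simp add: K(2))
  have eq: "h x * (\<Sum>i\<in>UNIV. Z' x (axis i 1) $ i) + h' x (Z x) = (\<Sum>i\<in>UNIV. ?g' i x (axis i 1))" for x
  proof -
    have "Z x = (\<Sum>i\<in>UNIV. Z x $ i *\<^sub>R axis i 1)"
      using basis_expansion[of "Z x"] by (simp add: scalar_mult_eq_scaleR)
    then have "h' x (Z x) = h' x (\<Sum>i\<in>UNIV. Z x $ i *\<^sub>R axis i 1)"
      by simp
    also have "\<dots> = (\<Sum>i\<in>UNIV. h' x (axis i 1) * Z x $ i)"
      using has_derivative_linear[OF h'(1)] by (simp add: linear_sum linear_cmul mult.commute)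
    finally show ?thesis by (simp add: sum.distrib sum_distrib_left)
  qed
  show "(LINT x|lborel. h x * (\<Sum>i\<in>UNIV. Z' x (axis i 1) $ i) + h' x (Z x)) = 0"
    unfolding eq using int zero by (subst Bochner_Integration.integral_sum) auto
  show "integrable lborel (\<lambda>x. h x * (\<Sum>i\<in>UNIV. Z' x (axis i 1) $ i) + h' x (Z x))"
    unfolding eq using int by auto
qed

definition stretch :: "('n::finite \<Rightarrow> real) \<Rightarrow> real ^ 'n \<Rightarrow> real ^ 'n" where
  "stretch d x = (\<chi> i. d i * x $ i)"

lemma stretch_nth [simp]: "stretch d x $ i = d i * x $ i"
  by (simp add: stretch_def)

lemma bounded_linear_stretch: "bounded_linear (stretch d)"
  by (rule linear_conv_bounded_linear[THEN iffD1], rule linearI) (auto simp: vec_eq_iff algebra_simps)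

lemma integral_stretch:
  fixes g :: "real ^ 'n::finite \<Rightarrow> real"
  assumes [measurable]: "g \<in> borel_measurable borel" and d: "\<And>i. d i > 0"
  shows "(LINT x|lborel. g x) = (\<Prod>i\<in>UNIV. d i) * (LINT x|lborel. g (stretch d x))"
proof -
  define c where "c j = (\<Sum>i\<in>UNIV. d i * j $ i)" for j :: "real ^ 'n"
  have c_axis: "c (axis i 1) = d i" for i
    by (simp add: c_def axis_def if_distrib cong: if_cong)
  have Basis: "(Basis :: (real ^ 'n) set) = range (\<lambda>i. axis i 1)"
    by (auto simp: Basis_vec_def)
  have inj: "inj (\<lambda>i::'n. axis i (1::real))"
    by (auto intro!: injI simp: axis_eq_axis)
  have T: "0 + (\<Sum>j\<in>Basis. (c j * (x \<bullet> j)) *\<^sub>R j) = stretch d x" for x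
    unfolding Basis using basis_expansion[of "stretch d x"]
    by (subst sum.reindex[OF inj]) (simp add: c_axis inner_axis scalar_mult_eq_scaleR)
  have P: "(\<Prod>j\<in>Basis. \<bar>c j\<bar>) = (\<Prod>i\<in>UNIV. d i)"
    unfolding Basis using d by (subst prod.reindex[OF inj]) (simp add: c_axis abs_of_pos)
  have "j \<in> Basis \<Longrightarrow> c j \<noteq> 0" for j
    using d by (auto simp: Basis c_axis less_imp_neq[symmetric])
  from lborel_affine_euclidean[of c 0, OF this, unfolded T P]
  have L: "lborel = density (distr lborel borel (stretch d)) (\<lambda>_. ennreal (\<Prod>i\<in>UNIV. d i))"
    by simp
  have [measurable]: "stretch d \<in> borel \<rightarrow>\<^sub>M borel"
    using bounded_linear_stretch[of d] by (intro borel_measurable_continuous_onI linear_continuous_on)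
  have "(\<Prod>i\<in>UNIV. d i) \<ge> 0"
    using d by (intro prod_nonneg) (auto intro: less_imp_le)
  then have "(LINT x|density (distr lborel borel (stretch d)) (\<lambda>_. ennreal (\<Prod>i\<in>UNIV. d i)). g x)
      = (LINT x|distr lborel borel (stretch d). (\<Prod>i\<in>UNIV. d i) *\<^sub>R g x)"
    by (intro integral_density) auto
  also have "\<dots> = (LINT x|lborel. (\<Prod>i\<in>UNIV. d i) *\<^sub>R g (stretch d x))"
    by (rule integral_distr) auto
  finally show ?thesis by (subst L) simp
qed


section \<open>Left invariant fields of the first stratum\<close>

lemma smooth_has_derivative:
  "smooth f \<Longrightarrow> (f has_derivative frechet_derivative f (at x)) (at x)"
  unfolding smooth_def by (metis C_diff.simps(2) frechet_derivative_works)

lemma smooth_continuous_derivative: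
  assumes "smooth f"
  shows "continuous_on A (\<lambda>x. frechet_derivative f (at x) v)"
proof -
  have "C_diff (Suc 0) f" using assms by (simp only: smooth_def)
  then have "continuous_on UNIV (\<lambda>x. frechet_derivative f (at x) v)" by simp
  then show ?thesis using continuous_on_subset by blast
qed

lemma smooth_continuous:
  assumes "smooth f"
  shows "continuous_on A f"
proof -
  have "C_diff 0 f" using assms by (simp only: smooth_def)
  then show ?thesis using continuous_on_subset by auto
qed

lemma dilation_eq_stretch: "dilation w r = stretch (\<lambda>i. r ^ w i)"
  by (simp add: fun_eq_iff dilation_def stretch_def)

lemma stretch_axis: "stretch d (axis k 1) = d k *\<^sub>R axis k 1"
  by (simp add: vec_eq_iff axis_def)

text \<open>
  Differentiate $D_r(x \circ y) = D_r x \circ D_r y$ in \<open>y\<close> at the identity, in direction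
  \<open>axis k 1\<close>, on which $D_r$ acts as multiplication by \<open>r\<close>. The derivative of a left
  translation at the identity carries $X_k(0)$ to $X_k$.
\<close>

lemma frame_homogeneous:
  assumes "stratified_group mul w" "horizontal_frame mul w X" "k \<in> stratum w 1" "r > 0"
  shows "r *\<^sub>R X k (dilation w r x) = dilation w r (X k x)"
proof -
  obtain ginv where "group mul 0 ginv" and smooth_mul: "smooth (\<lambda>(x, y). mul x y)"
    using assms(1) unfolding stratified_group_def lie_group_def by blast
  then interpret G: group mul 0 ginv by simp
  have D: "dilation w r (mul x y) = mul (dilation w r x) (dilation w r y)" for x y
    using assms(1,4) unfolding stratified_group_def lie_group_automorphism_def by blast
  define A where "A x = frechet_derivative (mul x) (at 0)" for x
  have A: "(mul x has_derivative A x) (at 0)" for x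
  proof -
    have "((\<lambda>y. (x, y)) has_derivative (\<lambda>v. (0, v))) (at 0)"
      by (auto intro!: derivative_eq_intros)
    from has_derivative_compose[OF this smooth_has_derivative[OF smooth_mul]]
    have "(mul x) differentiable (at 0)"
      by (auto simp: differentiable_def)
    then show ?thesis unfolding A_def by (simp add: frechet_derivative_works)
  qed
  have X: "X k x = A x (axis k 1)" for x
    using assms(2,3) G.right_neutral
    unfolding horizontal_frame_def left_invariant_def A_def by metis
  have lin: "bounded_linear (dilation w r)"
    unfolding dilation_eq_stretch by (rule bounded_linear_stretch)
  have zero: "dilation w r 0 = 0"
    by (simp add: dilation_eq_stretch vec_eq_iff)
  have "((\<lambda>y. dilation w r (mul x y)) has_derivative (\<lambda>v. dilation w r (A x v))) (at 0)"
    by (rule bounded_linear.has_derivative[OF lin A])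
  moreover have "((\<lambda>y. mul (dilation w r x) (dilation w r y)) has_derivative
      (\<lambda>v. A (dilation w r x) (dilation w r v))) (at 0)"
    by (rule has_derivative_compose[OF bounded_linear_imp_has_derivative[OF lin]])
      (simp add: zero A)
  ultimately have "(\<lambda>v. dilation w r (A x v)) = (\<lambda>v. A (dilation w r x) (dilation w r v))"
    unfolding D by (rule has_derivative_unique)
  from fun_cong[OF this, of "axis k 1"]
  have "dilation w r (X k x) = A (dilation w r x) (r *\<^sub>R axis k 1)"
    using assms(3) unfolding X by (simp add: dilation_eq_stretch stretch_axis stratum_def)
  also have "\<dots> = r *\<^sub>R X k (dilation w r x)"
    using has_derivative_linear[OF A] by (simp add: X linear_cmul)
  finally show ?thesis by simp
qed

lemma dilation_tendsto_0:
  assumes "\<And>i. 1 \<le> w i"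
  shows "(\<lambda>n. dilation w (inverse (real (Suc n))) x) \<longlonglongrightarrow> 0"
proof (rule vec_tendstoI)
  fix i
  have "(\<lambda>n. inverse (real (Suc n)) ^ w i * x $ i) \<longlonglongrightarrow> 0 ^ w i * x $ i"
    by (intro tendsto_intros LIMSEQ_inverse_real_of_nat)
  then show "(\<lambda>n. dilation w (inverse (real (Suc n))) x $ i) \<longlonglongrightarrow> 0 $ i"
    using assms[of i] by (simp add: dilation_def power_0_left)
qed

text \<open>
  This coefficient is invariant under dilations, hence equal to its value at the limit 0 of
  $D_r x$ as \<open>r\<close> tends to 0.
\<close>

lemma frame_first_layer:
  assumes "stratified_group mul w" "horizontal_frame mul w X" "k \<in> stratum w 1" "j \<in> stratum w 1"
  shows "X k x $ j = (if j = k then 1 else 0)"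
proof -
  have "smooth (X k)" and X0: "X k 0 = axis k 1"
    using assms(2,3) by (auto simp: horizontal_frame_def left_invariant_def)
  have w: "1 \<le> w i" for i using assms(1) by (auto simp: stratified_group_def)
  let ?D = "\<lambda>n. dilation w (inverse (real (Suc n))) x"
  have eq: "X k (?D n) $ j = X k x $ j" for n
    using arg_cong[OF frame_homogeneous[OF assms(1-3), of "inverse (real (Suc n))" x], of "\<lambda>v. v $ j"]
      assms(4) by (simp add: dilation_def stratum_def)
  have "isCont (X k) 0"
    using smooth_continuous[OF \<open>smooth (X k)\<close>, of UNIV] by (simp add: continuous_on_eq_continuous_at)
  then have "(\<lambda>n. X k (?D n) $ j) \<longlonglongrightarrow> X k 0 $ j"
    by (intro tendsto_vec_nth isCont_tendsto_compose[where g = "X k", OF _ dilation_tendsto_0[OF w]])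
  then have "X k 0 $ j = X k x $ j"
    by (simp only: eq LIMSEQ_const_iff)
  then show ?thesis by (simp add: X0 axis_def)
qed

text \<open>
  Differentiating the homogeneity relation gives $d(x) = r\, d(D_r x)$ for the derivative \<open>d\<close> in
  question, and the right-hand side tends to $0 \cdot d(0)$ as \<open>r\<close> tends to 0.
\<close>

lemma frame_diagonal_derivative_eq_0:
  assumes "stratified_group mul w" "horizontal_frame mul w X" "k \<in> stratum w 1"
  shows "frechet_derivative (X k) (at x) (axis j 1) $ j = 0"
proof -
  have sm: "smooth (X k)"
    using assms(2,3) by (auto simp: horizontal_frame_def left_invariant_def)
  have w: "1 \<le> w i" for i using assms(1) by (auto simp: stratified_group_def)
  let ?d = "\<lambda>x. frechet_derivative (X k) (at x) (axis j 1) $ j"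
  have eq: "?d x = r * ?d (dilation w r x)" if r: "r > 0" for r
  proof -
    let ?D = "dilation w r"
    have lin: "bounded_linear ?D"
      unfolding dilation_eq_stretch by (rule bounded_linear_stretch)
    have "((\<lambda>y. r *\<^sub>R X k (?D y)) has_derivative
        (\<lambda>v. r *\<^sub>R frechet_derivative (X k) (at (?D x)) (?D v))) (at x)"
      by (intro has_derivative_scaleR_right has_derivative_compose[OF bounded_linear_imp_has_derivative[OF lin]]
          smooth_has_derivative sm)
    moreover have "((\<lambda>y. ?D (X k y)) has_derivative
        (\<lambda>v. ?D (frechet_derivative (X k) (at x) v))) (at x)"
      by (intro bounded_linear.has_derivative[OF lin] smooth_has_derivative sm)
    ultimately have "(\<lambda>v. r *\<^sub>R frechet_derivative (X k) (at (?D x)) (?D v)) =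
        (\<lambda>v. ?D (frechet_derivative (X k) (at x) v))"
      unfolding frame_homogeneous[OF assms r] by (rule has_derivative_unique)
    from fun_cong[OF this, of "axis j 1"]
    have "r *\<^sub>R frechet_derivative (X k) (at (?D x)) (r ^ w j *\<^sub>R axis j 1) =
        ?D (frechet_derivative (X k) (at x) (axis j 1))"
      by (simp add: dilation_eq_stretch stretch_axis)
    from arg_cong[OF this, of "\<lambda>v. v $ j"]
    have "r * (r ^ w j * ?d (?D x)) = r ^ w j * ?d x"
      using linear_cmul[OF has_derivative_linear[OF smooth_has_derivative[OF sm]]]
      by (simp add: dilation_eq_stretch)
    then show ?thesis using r by simp
  qed
  let ?\<epsilon> = "\<lambda>n. inverse (real (Suc n))"
  have "isCont (\<lambda>y. frechet_derivative (X k) (at y) (axis j 1)) 0"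
    using smooth_continuous_derivative[OF sm, of UNIV] by (simp add: continuous_on_eq_continuous_at)
  then have "(\<lambda>n. ?\<epsilon> n * ?d (dilation w (?\<epsilon> n) x)) \<longlonglongrightarrow> 0 * ?d 0"
    by (intro tendsto_mult LIMSEQ_inverse_real_of_nat tendsto_vec_nth
        isCont_tendsto_compose[where g = "\<lambda>y. frechet_derivative (X k) (at y) (axis j 1)",
          OF _ dilation_tendsto_0[OF w]])
  moreover have "?\<epsilon> n * ?d (dilation w (?\<epsilon> n) x) = ?d x" for n
    by (rule eq[symmetric]) simp
  ultimately have "?d x = 0 * ?d 0"
    by (simp only: LIMSEQ_const_iff)
  then show ?thesis by simp
qed

definition radial_field :: "('n::finite \<Rightarrow> nat) \<Rightarrow> ('n \<Rightarrow> real ^ 'n \<Rightarrow> real ^ 'n) \<Rightarrow> real ^ 'n \<Rightarrow> real ^ 'n" where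
  "radial_field w X x = (\<Sum>k\<in>stratum w 1. x $ k *\<^sub>R X k x)"

definition radial_field_derivative ::
  "('n::finite \<Rightarrow> nat) \<Rightarrow> ('n \<Rightarrow> real ^ 'n \<Rightarrow> real ^ 'n) \<Rightarrow> real ^ 'n \<Rightarrow> real ^ 'n \<Rightarrow> real ^ 'n" where
  "radial_field_derivative w X x v =
     (\<Sum>k\<in>stratum w 1. x $ k *\<^sub>R frechet_derivative (X k) (at x) v + v $ k *\<^sub>R X k x)"

lemma horizontal_radial_eq_derivative:
  assumes "smooth f"
  shows "horizontal_radial w X f x = frechet_derivative f (at x) (radial_field w X x)"
  using has_derivative_linear[OF smooth_has_derivative[OF assms], of x]
  by (simp add: horizontal_radial_def radial_field_def vf_apply_def linear_sum linear_cmul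
      scaleR_conv_of_real[where 'a = complex])

context
  fixes mul :: "real ^ 'n \<Rightarrow> real ^ 'n \<Rightarrow> real ^ 'n::finite" and w X
  assumes sg: "stratified_group mul w" and hf: "horizontal_frame mul w X"
begin

lemma frame_smooth: "k \<in> stratum w 1 \<Longrightarrow> smooth (X k)"
  using hf by (auto simp: horizontal_frame_def left_invariant_def)

lemma radial_field_has_derivative:
  "(radial_field w X has_derivative radial_field_derivative w X x) (at x)"
  unfolding radial_field_def[abs_def] radial_field_derivative_def[abs_def]
  by (intro has_derivative_sum has_derivative_scaleR smooth_has_derivative frame_smooth
      bounded_linear_imp_has_derivative bounded_linear_vec_nth)

lemma continuous_radial_field_derivative:
  "continuous_on UNIV (\<lambda>x. radial_field_derivative w X x v)"
  unfolding radial_field_derivative_def[abs_def]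
  by (intro continuous_intros smooth_continuous_derivative smooth_continuous frame_smooth)

text \<open>
  Only the derivatives falling on the coefficients $x_k$ contribute.
\<close>

lemma radial_field_divergence:
  "(\<Sum>i\<in>UNIV. radial_field_derivative w X x (axis i 1) $ i) = card (stratum w 1)"
proof -
  have axis_nth: "axis i (1::real) $ k = (if i = k then 1 else 0)" for i k :: 'n
    by (simp add: axis_def)
  have "(\<Sum>i\<in>UNIV. radial_field_derivative w X x (axis i 1) $ i) =
      (\<Sum>i\<in>UNIV. \<Sum>k\<in>stratum w 1. (if i = k then 1 else 0) * X k x $ i)"
    by (intro sum.cong refl)
      (simp add: radial_field_derivative_def frame_diagonal_derivative_eq_0[OF sg hf] axis_nth)
  also have "\<dots> = (\<Sum>k\<in>stratum w 1. \<Sum>i\<in>UNIV. (if i = k then 1 else 0) * X k x $ i)"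
    by (rule sum.swap)
  also have "\<dots> = (\<Sum>k\<in>stratum w 1. X k x $ k)"
    by (intro sum.cong refl) (simp add: if_distrib[of "\<lambda>c. c * _"] cong: if_cong)
  also have "\<dots> = (\<Sum>k\<in>stratum w 1. 1)"
    by (intro sum.cong refl) (simp add: frame_first_layer[OF sg hf])
  finally show ?thesis by simp
qed

lemma radial_field_first_layer: "j \<in> stratum w 1 \<Longrightarrow> radial_field w X x $ j = x $ j"
  by (simp add: radial_field_def frame_first_layer[OF sg hf] if_distrib cong: if_cong)

lemma radial_field_eq_0: "(\<And>k. k \<in> stratum w 1 \<Longrightarrow> x $ k = 0) \<Longrightarrow> radial_field w X x = 0"
  by (simp add: radial_field_def)

lemma continuous_radial_field: "continuous_on A (radial_field w X)"
  using radial_field_has_derivative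
  by (meson continuous_at_imp_continuous_on has_derivative_continuous)

text \<open>
  The coefficients $x_k$ supply the factor \<open>r\<close> that is missing in \<open>frame_homogeneous\<close>:
  dilations preserve the field.
\<close>

lemma radial_field_homogeneous:
  assumes "r > 0"
  shows "radial_field w X (dilation w r x) = dilation w r (radial_field w X x)"
proof -
  have lin: "linear (dilation w r)"
    unfolding dilation_eq_stretch by (rule bounded_linear.linear[OF bounded_linear_stretch])
  have "radial_field w X (dilation w r x) = (\<Sum>k\<in>stratum w 1. x $ k *\<^sub>R (r *\<^sub>R X k (dilation w r x)))"
    unfolding radial_field_def
    by (intro sum.cong refl) (auto simp: dilation_def stratum_def mult.commute)
  also have "\<dots> = (\<Sum>k\<in>stratum w 1. dilation w r (x $ k *\<^sub>R X k x))"
    by (intro sum.cong refl) (simp only: frame_homogeneous[OF sg hf _ assms] linear_cmul[OF lin])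
  finally show ?thesis by (simp add: radial_field_def linear_sum[OF lin])
qed

end


section \<open>The Hardy identity\<close>

definition sq_norm_on :: "'n::finite set \<Rightarrow> real ^ 'n \<Rightarrow> real" where
  "sq_norm_on S x = (\<Sum>k\<in>S. (x $ k)\<^sup>2)"

lemma sq_norm_on_nonneg: "0 \<le> sq_norm_on S x"
  by (simp add: sq_norm_on_def sum_nonneg)

lemma sq_norm_on_eq_0_iff: "sq_norm_on S x = 0 \<longleftrightarrow> (\<forall>k\<in>S. x $ k = 0)"
  by (simp add: sq_norm_on_def sum_nonneg_eq_0_iff)

lemma sq_norm_on_has_derivative:
  "(sq_norm_on S has_derivative (\<lambda>v. \<Sum>k\<in>S. 2 * x $ k * v $ k)) (at x)"
  unfolding sq_norm_on_def[abs_def]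
  by (auto intro!: derivative_eq_intros bounded_linear_imp_has_derivative bounded_linear_vec_nth
      simp: power2_eq_square algebra_simps)

lemma continuous_on_sq_norm_on [continuous_intros]:
  "continuous_on A (sq_norm_on S)"
  unfolding sq_norm_on_def[abs_def] by (intro continuous_intros)

lemma cmod_divide_horizontal_norm:
  "(cmod (z / of_real (horizontal_norm w x)))\<^sup>2 = (cmod z)\<^sup>2 / sq_norm_on (stratum w 1) x"
  by (simp add: norm_divide power_divide horizontal_norm_def sq_norm_on_def sum_nonneg)

lemma integrable_weighted:
  fixes g :: "real ^ 'n::finite \<Rightarrow> complex"
  assumes "compact K" "continuous_on K g" "\<And>x. x \<notin> K \<Longrightarrow> g x = 0" "\<And>x. x \<in> K \<Longrightarrow> sq_norm_on S x \<noteq> 0"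
  shows "integrable lborel (\<lambda>x. (cmod (g x))\<^sup>2 / sq_norm_on S x)"
  using assms by (intro integrable_of_compact_support[OF assms(1)] continuous_intros) auto

text \<open>
  Let $h = |f|^2/s$. As the first-stratum components of \<open>Z\<close> are $x'$, we have $Z s = 2s$, so
  $\mathrm{div}(h Z) = 2 \,\mathrm{Re}(\bar f\, Zf)/s + 2c |f|^2/s$. Multiplied by \<open>c\<close>, this is the
  difference between $|Zf + cf|^2/s + c^2|f|^2/s$ and $|Zf|^2/s$, and its integral is zero.
\<close>

lemma hardy_identity:
  fixes f :: "real ^ 'n::finite \<Rightarrow> complex" and Z :: "real ^ 'n \<Rightarrow> real ^ 'n"
  assumes f: "smooth f" and K: "compact K" "\<And>x. x \<notin> K \<Longrightarrow> f x = 0"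
      "\<And>x. x \<in> K \<Longrightarrow> sq_norm_on S x \<noteq> 0"
    and Z': "\<And>x. (Z has_derivative Z' x) (at x)" "\<And>v. continuous_on UNIV (\<lambda>x. Z' x v)"
    and div: "\<And>x. (\<Sum>i\<in>UNIV. Z' x (axis i 1) $ i) = 2 * c + 2"
    and ZS: "\<And>x k. k \<in> S \<Longrightarrow> Z x $ k = x $ k"
  defines "F \<equiv> \<lambda>x. frechet_derivative f (at x) (Z x)"
  shows "(LINT x|lborel. (cmod (F x))\<^sup>2 / sq_norm_on S x) =
      c\<^sup>2 * (LINT x|lborel. (cmod (f x))\<^sup>2 / sq_norm_on S x) +
      (LINT x|lborel. (cmod (F x + c *\<^sub>R f x))\<^sup>2 / sq_norm_on S x)"
proof -
  let ?s = "sq_norm_on S" and ?Df = "\<lambda>x. frechet_derivative f (at x)"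
  define h where "h x = (cmod (f x))\<^sup>2 / ?s x" for x
  define h' where "h' x v = (if x \<in> K then
      2 * (f x \<bullet> ?Df x v) / ?s x - (cmod (f x))\<^sup>2 * (\<Sum>k\<in>S. 2 * x $ k * v $ k) / (?s x)\<^sup>2 else 0)" for x v
  note Df = smooth_has_derivative[OF f]
  have closed: "closed K" using K(1) by (rule compact_imp_closed)
  have h0: "h x = 0" if "x \<notin> K" for x using K(2)[OF that] by (simp add: h_def)
  have h_der: "(h has_derivative h' x) (at x)" for x
  proof (cases "x \<in> K")
    case True
    have "h = (\<lambda>x. (f x \<bullet> f x) / ?s x)"
      by (simp add: h_def fun_eq_iff power2_norm_eq_inner)
    moreover have nn: "cmod z * cmod z = z \<bullet> z" for z
      by (simp flip: power2_norm_eq_inner add: power2_eq_square)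
    moreover define ds where "ds v = (\<Sum>k\<in>S. 2 * x $ k * v $ k)" for v
    have "(?s has_derivative ds) (at x)"
      using sq_norm_on_has_derivative by (simp add: ds_def[abs_def])
    then have "((\<lambda>x. (f x \<bullet> f x) / ?s x) has_derivative (\<lambda>v. - (f x \<bullet> f x) *
        (inverse (?s x) * ds v * inverse (?s x)) + (f x \<bullet> ?Df x v + ?Df x v \<bullet> f x) / ?s x)) (at x)"
      using K(3)[OF True] by (intro has_derivative_divide has_derivative_inner Df)
    moreover have "h' x = (\<lambda>v. - (f x \<bullet> f x) *
        (inverse (?s x) * ds v * inverse (?s x)) + (f x \<bullet> ?Df x v + ?Df x v \<bullet> f x) / ?s x)"
      using True by (simp add: h'_def fun_eq_iff ds_def[symmetric] nn
          inner_commute divide_inverse power2_eq_square)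
    ultimately show ?thesis by simp
  next
    case False
    then have "h' x = (\<lambda>v. 0)" by (simp add: h'_def fun_eq_iff)
    then show ?thesis
      using has_derivative_zero_off_closed[of K h x, OF closed h0 False] by simp
  qed
  have fcont: "continuous_on A f" and Dfcont: "continuous_on A (\<lambda>x. ?Df x v)" for A v
    using f by (rule smooth_continuous, rule smooth_continuous_derivative)
  have "continuous_on K (\<lambda>x. h' x v)" for v
  proof -
    have "continuous_on K (\<lambda>x. 2 * (f x \<bullet> ?Df x v) / ?s x -
        (cmod (f x))\<^sup>2 * (\<Sum>k\<in>S. 2 * x $ k * v $ k) / (?s x)\<^sup>2)"
      using K(3) by (intro continuous_intros fcont Dfcont) auto
    then show ?thesis by (rule continuous_on_eq) (simp add: h'_def)
  qed
  note divergence = integral_divergence_eq_0[OF K(1) h0 h_der this Z', unfolded div]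
  have Df0: "?Df x v = 0" if "x \<notin> K" for x v
  proof -
    have "?Df x = (\<lambda>v. 0)"
      by (rule has_derivative_unique[OF Df has_derivative_zero_off_closed[OF closed K(2) that]])
    then show ?thesis by simp
  qed
  have Fcont: "continuous_on K F"
  proof -
    have "F x = (\<Sum>i\<in>UNIV. Z x $ i *\<^sub>R ?Df x (axis i 1))" for x
    proof -
      have "Z x = (\<Sum>i\<in>UNIV. Z x $ i *\<^sub>R axis i 1)"
        using basis_expansion[of "Z x"] by (simp add: scalar_mult_eq_scaleR)
      then have "F x = ?Df x (\<Sum>i\<in>UNIV. Z x $ i *\<^sub>R axis i 1)"
        by (simp add: F_def)
      then show ?thesis
        using has_derivative_linear[OF Df] by (simp add: linear_sum linear_cmul)
    qed
    moreover have "continuous_on K Z"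
      using Z'(1) by (meson continuous_at_imp_continuous_on has_derivative_continuous)
    ultimately show ?thesis
      by (simp add: continuous_on_sum continuous_on_scaleR continuous_on_component Dfcont)
  qed
  have int_f: "integrable lborel (\<lambda>x. (cmod (f x))\<^sup>2 / ?s x)"
    using K by (intro integrable_weighted[OF K(1)] fcont) auto
  have int_c: "integrable lborel (\<lambda>x. (cmod (F x + c *\<^sub>R f x))\<^sup>2 / ?s x)"
    using K by (intro integrable_weighted[OF K(1)] continuous_intros Fcont fcont) (auto simp: F_def Df0)
  \<comment> \<open>the subtracted term is \<open>c\<close> times the divergence of $(|f|^2/s) Z$\<close>
  have pointwise: "(cmod (F x))\<^sup>2 / ?s x = (c\<^sup>2 * ((cmod (f x))\<^sup>2 / ?s x) +
      (cmod (F x + c *\<^sub>R f x))\<^sup>2 / ?s x) - c * (h x * (2 * c + 2) + h' x (Z x))" for x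
  proof (cases "x \<in> K")
    case True
    then have s: "?s x \<noteq> 0" by (rule K(3))
    have "(\<Sum>k\<in>S. 2 * x $ k * Z x $ k) = 2 * ?s x"
      by (simp add: ZS sq_norm_on_def sum_distrib_left power2_eq_square mult.assoc)
    then have h'Z: "h' x (Z x) = 2 * (f x \<bullet> F x) / ?s x - 2 * (cmod (f x))\<^sup>2 / ?s x"
      using True s by (simp add: h'_def F_def power2_eq_square)
    have "(cmod (F x + c *\<^sub>R f x))\<^sup>2 = (cmod (F x))\<^sup>2 + 2 * c * (f x \<bullet> F x) + c\<^sup>2 * (cmod (f x))\<^sup>2"
      unfolding power2_norm_eq_inner
      by (simp add: inner_add inner_commute algebra_simps power2_eq_square)
    then show ?thesis
      using s by (simp add: h'Z h_def field_simps power2_eq_square)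
  next
    case False
    then show ?thesis by (simp add: F_def Df0 K(2) h_def h'_def)
  qed
  show ?thesis
    unfolding pointwise using int_f int_c divergence by (simp del: times_divide_eq_right)
qed

lemma test_function_support:
  assumes "f \<in> test_functions w"
  shows "smooth f" "compact (closure {x. f x \<noteq> 0})"
    "x \<notin> closure {x. f x \<noteq> 0} \<Longrightarrow> f x = 0"
    "x \<in> closure {x. f x \<noteq> 0} \<Longrightarrow> sq_norm_on (stratum w 1) x \<noteq> 0"
  using assms closure_subset[of "{x. f x \<noteq> 0}"] by (auto simp: test_functions_def sq_norm_on_eq_0_iff)

lemma stratified_hardy_identity:
  assumes sg: "stratified_group mul w" and hf: "horizontal_frame mul w X"
    and f: "f \<in> test_functions w"
  defines "c \<equiv> (real (card (stratum w 1)) - 2) / 2"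
  shows "(L2_norm (\<lambda>x. horizontal_radial w X f x / of_real (horizontal_norm w x)))\<^sup>2 =
      c\<^sup>2 * (L2_norm (\<lambda>x. f x / of_real (horizontal_norm w x)))\<^sup>2 +
      (LINT x|lborel. (cmod (frechet_derivative f (at x) (radial_field w X x) + c *\<^sub>R f x))\<^sup>2
         / sq_norm_on (stratum w 1) x)"
proof -
  note f = test_function_support[OF f]
  have L2: "(L2_norm g)\<^sup>2 = (LINT x|lborel. (cmod (g x))\<^sup>2)" for g :: "real ^ 'a \<Rightarrow> complex"
    by (simp add: L2_norm_def integral_nonneg_AE)
  show ?thesis
    unfolding L2 cmod_divide_horizontal_norm horizontal_radial_eq_derivative[OF f(1)]
    by (rule hardy_identity[OF f])
      (auto intro!: radial_field_has_derivative[OF sg hf] continuous_radial_field_derivative[OF sg hf]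
        simp: radial_field_divergence[OF sg hf] radial_field_first_layer[OF sg hf] c_def field_simps)
qed

lemma stratified_hardy_inequality:
  assumes "stratified_group mul w" "horizontal_frame mul w X" "f \<in> test_functions w"
  shows "(real (card (stratum w 1)) - 2) / 2 * L2_norm (\<lambda>x. f x / of_real (horizontal_norm w x))
      \<le> L2_norm (\<lambda>x. horizontal_radial w X f x / of_real (horizontal_norm w x))"
proof (rule power2_le_imp_le)
  have "0 \<le> (LINT x|lborel. (cmod (frechet_derivative f (at x) (radial_field w X x) +
      ((real (card (stratum w 1)) - 2) / 2) *\<^sub>R f x))\<^sup>2 / sq_norm_on (stratum w 1) x)"
    by (intro integral_nonneg_AE AE_I2 divide_nonneg_nonneg sq_norm_on_nonneg) auto
  then show "((real (card (stratum w 1)) - 2) / 2 * L2_norm (\<lambda>x. f x / of_real (horizontal_norm w x)))\<^sup>2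
      \<le> (L2_norm (\<lambda>x. horizontal_radial w X f x / of_real (horizontal_norm w x)))\<^sup>2"
    unfolding stratified_hardy_identity[OF assms] power_mult_distrib by linarith
  show "0 \<le> L2_norm (\<lambda>x. horizontal_radial w X f x / of_real (horizontal_norm w x))"
    by (simp add: L2_norm_def integral_nonneg_AE)
qed


section \<open>Blowing up the strata above the first\<close>

lemma C_diff_compose_linear:
  assumes "bounded_linear T" "C_diff k f"
  shows "C_diff k (\<lambda>x. f (T x))"
  using assms(2)
proof (induction k arbitrary: f)
  case 0
  then show ?case
    using linear_continuous_on[OF assms(1)] by (auto intro: continuous_on_compose2)
next
  case (Suc k)
  have "((\<lambda>x. f (T x)) has_derivative (\<lambda>v. frechet_derivative f (at (T x)) (T v))) (at x)" for x
    using Suc.prems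
    by (intro has_derivative_compose[OF bounded_linear_imp_has_derivative[OF assms(1)]])
      (simp add: frechet_derivative_works)
  moreover have "C_diff_on k UNIV (\<lambda>x. frechet_derivative f (at (T x)) (T v))" for v
    using Suc.IH[of "\<lambda>y. frechet_derivative f (at y) (T v)"] Suc.prems
    by (simp add: C_diff_iff_C_diff_on_UNIV)
  ultimately show ?case
    unfolding C_diff_iff_C_diff_on_UNIV by (intro C_diff_on_SucI) auto
qed

lemma test_functions_stretch:
  assumes f: "f \<in> test_functions w" and d: "\<And>i. d i \<noteq> 0"
  shows "(\<lambda>x. f (stretch d x)) \<in> test_functions w"
proof -
  let ?K = "closure {x. f x \<noteq> 0}" and ?S = "stretch (\<lambda>i. inverse (d i))"
  have inv: "?S (stretch d x) = x" "stretch d (?S x) = x" for x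
    using d by (auto simp: vec_eq_iff)
  have "compact (?S ` ?K)"
    by (rule compact_continuous_image[OF linear_continuous_on[OF bounded_linear_stretch]
          test_function_support(2)[OF f]])
  moreover have sub: "closure {x. f (stretch d x) \<noteq> 0} \<subseteq> ?S ` ?K"
  proof (rule closure_minimal)
    show "{x. f (stretch d x) \<noteq> 0} \<subseteq> ?S ` ?K"
    proof
      fix x assume "x \<in> {x. f (stretch d x) \<noteq> 0}"
      then have "stretch d x \<in> ?K"
        using test_function_support(3)[OF f, of "stretch d x"] by auto
      then have "?S (stretch d x) \<in> ?S ` ?K" by (rule imageI)
      then show "x \<in> ?S ` ?K" by (simp only: inv)
    qed
  qed (use calculation compact_imp_closed in blast)
  ultimately have "compact (closure {x. f (stretch d x) \<noteq> 0})"
    using bounded_subset compact_imp_bounded by (auto simp: compact_eq_bounded_closed)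
  moreover have "\<exists>k\<in>stratum w 1. x $ k \<noteq> 0" if "x \<in> closure {x. f (stretch d x) \<noteq> 0}" for x
  proof -
    obtain y where "x = ?S y" "y \<in> ?K" using sub \<open>x \<in> _\<close> by blast
    then show ?thesis
      using f d by (auto simp: test_functions_def subset_iff)
  qed
  moreover have "smooth (\<lambda>x. f (stretch d x))"
    using test_function_support(1)[OF f]
    by (simp add: smooth_def C_diff_compose_linear bounded_linear_stretch)
  ultimately show ?thesis by (auto simp: test_functions_def)
qed

definition layer_projection :: "'n::finite set \<Rightarrow> real ^ 'n \<Rightarrow> real ^ 'n" where
  "layer_projection S = stretch (\<lambda>i. if i \<in> S then 1 else 0)"

text \<open>
  For $r \le 1$ let \<open>T\<close> multiply the \<open>i\<close>-th coordinate by $r^{w_i}$ off the first stratum and fix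
  the first stratum. Apply the assumed inequality to $f \circ T$ and change variables:
  the Jacobian is common to both sides, and the field \<open>Z\<close> becomes $T Z T^{-1}$. By homogeneity
  of \<open>Z\<close> its coefficients off the first stratum are those of \<open>Z\<close> at the point
  $(r x', x'')$, and so they tend to zero with \<open>r\<close>, because \<open>Z\<close> vanishes where $x' = 0$. This
  leaves the Euler field, whose coefficient map is \<open>layer_projection\<close>.
\<close>

lemma blow_up_inequality:
  fixes mul :: "real ^ 'n \<Rightarrow> real ^ 'n \<Rightarrow> real ^ 'n::finite"
  assumes sg: "stratified_group mul w" and hf: "horizontal_frame mul w X"
    and C: "C \<ge> 0" "\<And>f. f \<in> test_functions w \<Longrightarrow>
        C * L2_norm (\<lambda>x. f x / of_real (horizontal_norm w x))
        \<le> L2_norm (\<lambda>x. horizontal_radial w X f x / of_real (horizontal_norm w x))"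
    and f: "f \<in> test_functions w"
  defines "c \<equiv> (real (card (stratum w 1)) - 2) / 2" and "S \<equiv> stratum w 1"
  shows "(C\<^sup>2 - c\<^sup>2) * (LINT x|lborel. (cmod (f x))\<^sup>2 / sq_norm_on S x) \<le>
    (LINT x|lborel. (cmod (frechet_derivative f (at x) (layer_projection S x) + c *\<^sub>R f x))\<^sup>2 / sq_norm_on S x)"
proof -
  let ?Z = "radial_field w X" and ?s = "sq_norm_on S" and ?Df = "\<lambda>x. frechet_derivative f (at x)"
  define K where "K = closure {x. f x \<noteq> 0}"
  note supp = test_function_support[OF f, folded K_def S_def]
  note Df = smooth_has_derivative[OF supp(1)]
  have fcont: "continuous_on A f" and Dfcont: "continuous_on A (\<lambda>x. ?Df x v)" for A v
    using supp(1) by (rule smooth_continuous, rule smooth_continuous_derivative)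
  have L2: "(L2_norm g)\<^sup>2 = (LINT x|lborel. (cmod (g x))\<^sup>2)" for g :: "real ^ 'n \<Rightarrow> complex"
    by (simp add: L2_norm_def integral_nonneg_AE)
  have basic: "(C\<^sup>2 - c\<^sup>2) * (LINT x|lborel. (cmod (g x))\<^sup>2 / ?s x) \<le>
      (LINT x|lborel. (cmod (frechet_derivative g (at x) (?Z x) + c *\<^sub>R g x))\<^sup>2 / ?s x)"
    if g: "g \<in> test_functions w" for g
  proof -
    have "(C * L2_norm (\<lambda>x. g x / of_real (horizontal_norm w x)))\<^sup>2
        \<le> (L2_norm (\<lambda>x. horizontal_radial w X g x / of_real (horizontal_norm w x)))\<^sup>2"
      using C g by (intro power_mono mult_nonneg_nonneg) (auto simp: L2_norm_def integral_nonneg_AE)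
    then show ?thesis
      unfolding stratified_hardy_identity[OF sg hf g] power_mult_distrib
      unfolding L2 cmod_divide_horizontal_norm
      by (simp add: c_def S_def algebra_simps)
  qed
  \<comment> \<open>\<open>W (r, _)\<close> is the conjugate of \<open>Z\<close> by the anisotropic stretching; written this way it is defined and continuous up to \<open>r = 0\<close>\<close>
  define W where "W = (\<lambda>(\<epsilon>, y). \<chi> i. if i \<in> S then y $ i else
      ?Z (stretch (\<lambda>i. if i \<in> S then \<epsilon> else 1) y) $ i)"
  define \<Psi> where "\<Psi> \<epsilon> y = (cmod (?Df y (W (\<epsilon>, y)) + c *\<^sub>R f y))\<^sup>2 / ?s y" for \<epsilon> y
  have "continuous_on UNIV W"
    unfolding W_def case_prod_unfold
  proof (rule continuous_on_vec_lambda)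
    fix i
    have "continuous_on UNIV (\<lambda>p :: real \<times> (real ^ 'n). stretch (\<lambda>i. if i \<in> S then fst p else 1) (snd p))"
      unfolding stretch_def
    proof (rule continuous_on_vec_lambda)
      fix i
      show "continuous_on UNIV (\<lambda>p :: real \<times> (real ^ 'n). (if i \<in> S then fst p else 1) * snd p $ i)"
        by (cases "i \<in> S") (auto intro!: continuous_intros)
    qed
    then have "continuous_on UNIV (\<lambda>p. ?Z (stretch (\<lambda>i. if i \<in> S then fst p else 1) (snd p)))"
      by (rule continuous_on_compose2[OF continuous_radial_field[OF sg hf, of UNIV]]) simp
    then show "continuous_on UNIV (\<lambda>p. if i \<in> S then snd p $ i
        else ?Z (stretch (\<lambda>i. if i \<in> S then fst p else 1) (snd p)) $ i)"
      by (cases "i \<in> S") (auto intro!: continuous_intros)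
  qed
  then have Wcont: "continuous_on A W" for A
    using continuous_on_subset by blast
  have "continuous_on ({0..1} \<times> K) (\<lambda>p. \<Psi> (fst p) (snd p))"
  proof -
    have expand: "?Df y v = (\<Sum>i\<in>UNIV. v $ i *\<^sub>R ?Df y (axis i 1))" for y v
    proof -
      have "?Df y v = ?Df y (\<Sum>i\<in>UNIV. v $ i *\<^sub>R axis i 1)"
        using basis_expansion[of v] by (simp add: scalar_mult_eq_scaleR)
      then show ?thesis
        using has_derivative_linear[OF Df] by (simp add: linear_sum linear_cmul)
    qed
    have eq: "\<Psi> (fst p) (snd p) = (cmod ((\<Sum>i\<in>UNIV. W p $ i *\<^sub>R ?Df (snd p) (axis i 1)) +
        c *\<^sub>R f (snd p)))\<^sup>2 / ?s (snd p)" for p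
      unfolding \<Psi>_def by (subst expand) simp
    let ?Q = "{0..1::real} \<times> K"
    have f2: "continuous_on ?Q (\<lambda>p. f (snd p))"
      by (rule continuous_on_compose2[OF fcont[of UNIV] continuous_on_snd[OF continuous_on_id]]) simp
    have Df2: "continuous_on ?Q (\<lambda>p. ?Df (snd p) v)" for v
      by (rule continuous_on_compose2[OF Dfcont[of UNIV] continuous_on_snd[OF continuous_on_id]]) simp
    have s2: "continuous_on ?Q (\<lambda>p. ?s (snd p))"
      by (rule continuous_on_compose2[OF continuous_on_sq_norm_on[of UNIV] continuous_on_snd[OF continuous_on_id]]) simp
    show ?thesis
      unfolding eq
      by (intro continuous_on_divide continuous_on_power continuous_on_norm continuous_on_add
          continuous_on_sum continuous_on_scaleR continuous_on_component continuous_on_const Wcont f2 Df2 s2)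
        (use supp(4) in auto)
  qed
  note \<Psi>cont = this
  then have "bounded ((\<lambda>p. \<Psi> (fst p) (snd p)) ` ({0..1} \<times> K))"
    using supp(2) by (intro compact_imp_bounded compact_continuous_image compact_Times) auto
  then obtain M where M: "\<bar>\<Psi> \<epsilon> y\<bar> \<le> M" if "0 \<le> \<epsilon>" "\<epsilon> \<le> 1" "y \<in> K" for \<epsilon> y
    unfolding bounded_iff by fastforce
  have off: "\<Psi> \<epsilon> y = 0" if "y \<notin> K" for \<epsilon> y
  proof -
    have "?Df y = (\<lambda>v. 0)"
      by (rule has_derivative_unique[OF Df has_derivative_zero_off_closed[OF _ supp(3) that]])
        (simp add: K_def)
    then show ?thesis using supp(3)[OF that] by (simp add: \<Psi>_def)
  qed
  have \<Psi>int: "integrable lborel (\<Psi> \<epsilon>)" if "0 \<le> \<epsilon>" "\<epsilon> \<le> 1" for \<epsilon>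
  proof (rule integrable_of_compact_support[OF supp(2) _ off])
    have 1: "continuous_on K (\<lambda>y. (\<epsilon>, y))"
      by (intro continuous_on_Pair continuous_on_const continuous_on_id)
    have 2: "(\<lambda>y. (\<epsilon>, y)) ` K \<subseteq> {0..1} \<times> K"
      using that by auto
    show "continuous_on K (\<Psi> \<epsilon>)"
      using continuous_on_compose2[OF \<Psi>cont 1 2] by (simp only: fst_conv snd_conv)
  qed
  have ineq: "(C\<^sup>2 - c\<^sup>2) * (LINT x|lborel. (cmod (f x))\<^sup>2 / ?s x) \<le> (LINT x|lborel. \<Psi> r x)"
    if r: "0 < r" "r \<le> 1" for r
  proof -
    define d where "d i = (if i \<in> S then 1 else r ^ w i)" for i
    define P where "P = (\<Prod>i\<in>UNIV. d i)"
    let ?T = "stretch d"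
    have d: "0 < d i" for i using r by (simp add: d_def)
    have "P > 0" unfolding P_def using d by (simp add: prod_pos)
    have sT: "?s (?T x) = ?s x" for x
      by (simp add: sq_norm_on_def d_def)
    have WT: "W (r, ?T x) = ?T (?Z x)" for x
    proof -
      have eq: "stretch (\<lambda>i. if i \<in> S then r else 1) (?T x) = dilation w r x"
        by (auto simp: vec_eq_iff d_def dilation_def S_def stratum_def)
      have "W (r, ?T x) $ i = ?T (?Z x) $ i" for i
      proof (cases "i \<in> S")
        case True
        then show ?thesis
          using radial_field_first_layer[OF sg hf, of i x] by (simp add: W_def d_def S_def)
      next
        case False
        then have "W (r, ?T x) $ i = dilation w r (?Z x) $ i"
          by (simp add: W_def eq radial_field_homogeneous[OF sg hf r(1)])
        then show ?thesis using False by (simp add: d_def dilation_def)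
      qed
      then show ?thesis by (simp add: vec_eq_iff)
    qed
    have "frechet_derivative (\<lambda>x. f (?T x)) (at x) = (\<lambda>v. ?Df (?T x) (?T v))" for x
      by (rule frechet_derivative_at[symmetric])
        (rule has_derivative_compose[OF bounded_linear_imp_has_derivative[OF bounded_linear_stretch] Df])
    then have \<Psi>T: "\<Psi> r (?T x) = (cmod (frechet_derivative (\<lambda>x. f (?T x)) (at x) (?Z x) + c *\<^sub>R f (?T x)))\<^sup>2 / ?s x" for x
      by (simp add: \<Psi>_def WT sT)
    have "f \<in> borel_measurable borel" "?s \<in> borel_measurable borel"
      by (intro borel_measurable_continuous_onI fcont continuous_on_sq_norm_on)+
    then have "(LINT x|lborel. (cmod (f x))\<^sup>2 / ?s x) = P * (LINT x|lborel. (cmod (f (?T x)))\<^sup>2 / ?s x)"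
      using integral_stretch[of "\<lambda>x. (cmod (f x))\<^sup>2 / ?s x" d] d by (simp add: P_def sT)
    moreover have "(LINT x|lborel. \<Psi> r x) = P * (LINT x|lborel. \<Psi> r (?T x))"
      using integral_stretch[of "\<Psi> r" d] d \<Psi>int[of r] r by (simp add: P_def integrable_iff_bounded)
    moreover have "(C\<^sup>2 - c\<^sup>2) * (LINT x|lborel. (cmod (f (?T x)))\<^sup>2 / ?s x) \<le> (LINT x|lborel. \<Psi> r (?T x))"
      unfolding \<Psi>T using d by (intro basic test_functions_stretch f) (auto simp: less_imp_neq[symmetric])
    ultimately show ?thesis
      using \<open>P > 0\<close> by (simp add: mult.left_commute[of _ P])
  qed
  define \<epsilon> where "\<epsilon> n = inverse (real (Suc n))" for n
  have \<epsilon>: "0 < \<epsilon> n" "\<epsilon> n \<le> 1" "0 \<le> \<epsilon> n" for n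
    by (auto simp: \<epsilon>_def field_simps)
  have "(\<lambda>n. LINT x|lborel. \<Psi> (\<epsilon> n) x) \<longlonglongrightarrow> (LINT x|lborel. \<Psi> 0 x)"
  proof (rule integral_dominated_convergence[where w = "\<lambda>x. indicator K x *\<^sub>R M"])
    show "\<Psi> 0 \<in> borel_measurable lborel" "\<Psi> (\<epsilon> n) \<in> borel_measurable lborel" for n
      using \<Psi>int[of 0] \<Psi>int[of "\<epsilon> n"] \<epsilon>[of n] by (auto simp: integrable_iff_bounded)
    show "integrable lborel (\<lambda>x. indicator K x *\<^sub>R M)"
      using supp(2) by (intro borel_integrable_compact) auto
    show "AE x in lborel. norm (\<Psi> (\<epsilon> n) x) \<le> indicator K x *\<^sub>R M" for n
    proof (rule AE_I2)
      fix x show "norm (\<Psi> (\<epsilon> n) x) \<le> indicator K x *\<^sub>R M"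
        using M[of "\<epsilon> n" x] off[of x "\<epsilon> n"] \<epsilon>[of n] by (cases "x \<in> K") auto
    qed
    show "AE x in lborel. (\<lambda>n. \<Psi> (\<epsilon> n) x) \<longlonglongrightarrow> \<Psi> 0 x"
    proof (rule AE_I2)
      fix x
      show "(\<lambda>n. \<Psi> (\<epsilon> n) x) \<longlonglongrightarrow> \<Psi> 0 x"
      proof (cases "x \<in> K")
        case True
        have 1: "continuous_on {0..1} (\<lambda>r. (r, x))"
          by (intro continuous_on_Pair continuous_on_const continuous_on_id)
        have 2: "(\<lambda>r. (r, x)) ` {0..1} \<subseteq> {0..1} \<times> K"
          using True by auto
        have "continuous_on {0..1} (\<lambda>r. \<Psi> r x)"
          using continuous_on_compose2[OF \<Psi>cont 1 2] by (simp only: fst_conv snd_conv)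
        moreover have "\<epsilon> \<longlonglongrightarrow> 0"
          using LIMSEQ_inverse_real_of_nat by (simp add: \<epsilon>_def[abs_def])
        ultimately show ?thesis
          using \<epsilon> by (auto intro: continuous_on_tendsto_compose[of "{0..1}" "\<lambda>r. \<Psi> r x"])
      next
        case False
        then show ?thesis using off by simp
      qed
    qed
  qed
  then have "(C\<^sup>2 - c\<^sup>2) * (LINT x|lborel. (cmod (f x))\<^sup>2 / ?s x) \<le> (LINT x|lborel. \<Psi> 0 x)"
    using \<epsilon> ineq by (intro LIMSEQ_le_const) auto
  moreover have "W (0, y) = layer_projection S y" for y
  proof -
    have "?Z (stretch (\<lambda>i. if i \<in> S then 0 else 1) y) = 0"
      by (rule radial_field_eq_0[OF sg hf]) (auto simp: S_def)
    then show ?thesis by (simp add: W_def layer_projection_def vec_eq_iff)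
  qed
  ultimately show ?thesis by (simp add: \<Psi>_def)
qed


section \<open>Annuli of equal mass\<close>

text \<open>
  The density $|x'|^{-N}$ times the square of the fixed cutoff in the coordinates
  outside \<open>S\<close> that the near minimizers carry. Stretching $x'$ preserves the corresponding
  measure.
\<close>

definition annulus_weight :: "'n::finite set \<Rightarrow> real ^ 'n \<Rightarrow> real" where
  "annulus_weight S x =
     sq_norm_on S x powr (- (real (card S) / 2)) * (flat 0 (1 - sq_norm_on (- S) x))\<^sup>2"

definition annulus_mass :: "'n::finite set \<Rightarrow> real \<Rightarrow> real \<Rightarrow> real" where
  "annulus_mass S a b =
     (LINT x|lborel. indicator {x. a \<le> sq_norm_on S x \<and> sq_norm_on S x < b} x * annulus_weight S x)"

text \<open>
  Compact sets that contain the supports of the annulus densities and of the near minimizers.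
\<close>

definition slab :: "'n::finite set \<Rightarrow> real \<Rightarrow> real \<Rightarrow> (real ^ 'n) set" where
  "slab S a b = {x. a \<le> sq_norm_on S x \<and> sq_norm_on S x \<le> b \<and> sq_norm_on (- S) x \<le> 1}"

lemma closed_slab: "closed (slab S a b)"
  unfolding slab_def
  by (intro closed_Collect_conj closed_Collect_le continuous_intros)

lemma compact_slab: "compact (slab S a b)"
proof -
  have "norm x \<le> sqrt (b + 1)" if "x \<in> slab S a b" for x
  proof -
    have "(\<Sum>i\<in>UNIV. (x $ i)\<^sup>2) = sq_norm_on S x + sq_norm_on (- S) x"
      unfolding sq_norm_on_def by (subst sum.union_disjoint[symmetric]) (auto simp: Compl_partition)
    then have "norm x = sqrt (sq_norm_on S x + sq_norm_on (- S) x)"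
      by (simp add: norm_vec_def L2_set_def)
    then show ?thesis using that by (simp add: slab_def)
  qed
  then have "bounded (slab S a b)" unfolding bounded_iff by blast
  then show ?thesis by (simp add: compact_eq_bounded_closed closed_slab)
qed

lemma flat_pos: "0 < x \<Longrightarrow> 0 < flat n x"
  by (simp add: flat_def)

lemma flat_eq_0: "x \<le> 0 \<Longrightarrow> flat n x = 0"
  by (simp add: flat_def)

lemma continuous_on_flat [continuous_intros]:
  "continuous_on A g \<Longrightarrow> continuous_on A (\<lambda>x. flat n (g x))"
  using C_diff_on_flat[of 0 n] continuous_on_compose2[of UNIV "flat n" A g] by simp

lemma annulus_weight_nonneg: "0 \<le> annulus_weight S x"
  by (simp add: annulus_weight_def)

lemma continuous_on_annulus_weight:
  "(\<And>x. x \<in> A \<Longrightarrow> 0 < sq_norm_on S x) \<Longrightarrow> continuous_on A (annulus_weight S)"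
  unfolding annulus_weight_def[abs_def] by (auto intro!: continuous_intros simp: less_imp_neq[symmetric])

lemma borel_measurable_sq_norm_on [measurable]: "sq_norm_on S \<in> borel_measurable borel"
  by (intro borel_measurable_continuous_onI continuous_intros)

lemma borel_measurable_flat [measurable]: "flat n \<in> borel_measurable borel"
  using C_diff_on_flat[of 0 n] by (intro borel_measurable_continuous_onI) simp

lemma borel_measurable_annulus_weight [measurable]: "annulus_weight S \<in> borel_measurable borel"
  unfolding annulus_weight_def[abs_def] by measurable

lemma integrable_annulus:
  assumes "0 < a"
  shows "integrable lborel
    (\<lambda>x. indicator {x. a \<le> sq_norm_on S x \<and> sq_norm_on S x < b} x * annulus_weight S x)"
proof (rule Bochner_Integration.integrable_bound)
  show "integrable lborel (\<lambda>x. indicator (slab S a b) x *\<^sub>R annulus_weight S x)"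
    by (intro borel_integrable_compact compact_slab continuous_on_annulus_weight)
      (use assms in \<open>auto simp: slab_def\<close>)
  show "(\<lambda>x. indicator {x. a \<le> sq_norm_on S x \<and> sq_norm_on S x < b} x * annulus_weight S x)
      \<in> borel_measurable lborel" by measurable
  have "annulus_weight S x = 0" if "\<not> sq_norm_on (- S) x \<le> 1" for x :: "real ^ 'a"
    using that by (simp add: annulus_weight_def flat_eq_0)
  then show "AE x in lborel. norm (indicator {x. a \<le> sq_norm_on S x \<and> sq_norm_on S x < b} x * annulus_weight S x)
      \<le> norm (indicator (slab S a b) x *\<^sub>R annulus_weight S x)"
    by (auto simp: indicator_def slab_def)
qed

lemma annulus_mass_add:
  assumes "0 < a" "a \<le> b" "b \<le> c"
  shows "annulus_mass S a c = annulus_mass S a b + annulus_mass S b c"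
proof -
  let ?g = "\<lambda>a b x. indicator {x. a \<le> sq_norm_on S x \<and> sq_norm_on S x < b} x * annulus_weight S x"
  have "?g a c x = ?g a b x + ?g b c x" for x
    using assms by (auto simp: indicator_def)
  moreover have "integrable lborel (?g a b)" "integrable lborel (?g b c)"
    using assms by (intro integrable_annulus; simp)+
  ultimately show ?thesis
    unfolding annulus_mass_def by (simp only: Bochner_Integration.integral_add)
qed

text \<open>
  Doubling $x'$ multiplies Lebesgue measure by $2^N$ and the density by $4^{-N/2}$.
\<close>

lemma annulus_mass_scale:
  "annulus_mass S (4 * a) (4 * b) = annulus_mass S a b"
proof -
  define d where "d i = (if i \<in> S then 2 else 1 :: real)" for i
  have s: "sq_norm_on S (stretch d x) = 4 * sq_norm_on S x" for x
    by (simp add: sq_norm_on_def d_def power_mult_distrib sum_distrib_left)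
  have q: "sq_norm_on (- S) (stretch d x) = sq_norm_on (- S) x" for x
    by (simp add: sq_norm_on_def d_def)
  have P: "(\<Prod>i\<in>UNIV. d i) = 2 ^ card S"
    by (simp add: d_def prod.If_cases)
  have "(4::real) powr (- (real (card S) / 2)) = (2 powr 2) powr (- (real (card S) / 2))"
    by simp
  also have "\<dots> = 2 powr (- real (card S))"
    by (simp only: powr_powr) simp
  also have "\<dots> = 1 / 2 ^ card S"
    by (simp add: powr_minus_divide powr_realpow)
  finally have "annulus_weight S (stretch d x) = annulus_weight S x / 2 ^ card S" for x
    by (simp add: annulus_weight_def s q powr_mult)
  then have "indicator {x. 4 * a \<le> sq_norm_on S x \<and> sq_norm_on S x < 4 * b} (stretch d x) * annulus_weight S (stretch d x)
      = (indicator {x. a \<le> sq_norm_on S x \<and> sq_norm_on S x < b} x * annulus_weight S x) / 2 ^ card S" for x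
    by (simp add: s indicator_def)
  moreover have "annulus_mass S (4 * a) (4 * b) = (\<Prod>i\<in>UNIV. d i) * (LINT x|lborel.
      indicator {x. 4 * a \<le> sq_norm_on S x \<and> sq_norm_on S x < 4 * b} (stretch d x) * annulus_weight S (stretch d x))"
    unfolding annulus_mass_def by (rule integral_stretch) (auto simp: d_def)
  ultimately show ?thesis by (simp add: P annulus_mass_def)
qed

lemma annulus_mass_powers:
  "annulus_mass S (4 ^ j) (4 ^ (j + l)) = l * annulus_mass S 1 4"
proof (induction l)
  case 0
  then show ?case by (simp add: annulus_mass_def)
next
  case (Suc l)
  have "annulus_mass S (4 ^ k) (4 ^ Suc k) = annulus_mass S 1 4" for k
  proof (induction k)
    case (Suc k)
    then show ?case
      using annulus_mass_scale[of S "4 ^ k" "4 ^ Suc k"] by (simp only: power_Suc)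
  qed simp
  then show ?case
    using Suc annulus_mass_add[of "4 ^ j" "4 ^ (j + l)" "4 ^ Suc (j + l)" S]
    by (simp add: power_increasing algebra_simps)
qed

text \<open>
  The density is positive on a nonempty open subset of the annulus.
\<close>

lemma annulus_mass_pos:
  assumes "S \<noteq> {}"
  shows "0 < annulus_mass S 1 4"
proof -
  let ?g = "\<lambda>x. indicator {x. 1 \<le> sq_norm_on S x \<and> sq_norm_on S x < 4} x * annulus_weight S x"
  let ?U = "{x. 1 < sq_norm_on S x \<and> sq_norm_on S x < 4 \<and> sq_norm_on (- S) x < 1}"
  have "annulus_mass S 1 4 \<noteq> 0"
  proof
    assume "annulus_mass S 1 4 = 0"
    then have "AE x in lborel. ?g x = 0"
      using integrable_annulus[of 1 S 4]
      by (subst (asm) annulus_mass_def, subst (asm) integral_nonneg_eq_0_iff_AE)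
        (auto simp: annulus_weight_nonneg)
    \<comment> \<open>the density is positive on \<open>?U\<close>, an open set\<close>
    then have "AE x in lborel. x \<notin> ?U"
    proof eventually_elim
      case (elim x)
      have "annulus_weight S x > 0" if "x \<in> ?U"
        using that unfolding annulus_weight_def
        by (intro mult_pos_pos zero_less_power flat_pos) auto
      then show ?case using elim by (auto simp: indicator_def)
    qed
    moreover have "open ?U"
      by (intro open_Collect_conj open_Collect_less continuous_intros)
    ultimately have "?U \<in> null_sets lborel"
      by (subst AE_iff_null_sets) auto
    then have "negligible ?U"
      by (simp add: negligible_iff_null_sets null_sets_completionI)
    moreover obtain k where k: "k \<in> S" using assms by blast
    have "sq_norm_on T (axis k a) = (if k \<in> T then a\<^sup>2 else 0)" for T :: "'a set" and a
    proof -
      have "(axis k a $ i)\<^sup>2 = (if i = k then a\<^sup>2 else 0)" for i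
        by (simp add: axis_def)
      then show ?thesis by (simp add: sq_norm_on_def)
    qed
    with k have "axis k (3 / 2) \<in> ?U"
      by (simp add: power2_eq_square)
    ultimately show False using open_not_negligible[OF \<open>open ?U\<close>] by blast
  qed
  moreover have "0 \<le> annulus_mass S 1 4"
    unfolding annulus_mass_def by (intro integral_nonneg_AE) (auto simp: annulus_weight_nonneg)
  ultimately show ?thesis by simp
qed


section \<open>Near minimizers\<close>

text \<open>
  A bump supported on $[1, 64]$; the values on $[4, 16]$ serve for the lower bound of the norm.
  In the variable $t = s^{1/m}$ these intervals become $[1, 4^{3m}]$ and $[4^m, 4^{2m}]$ for \<open>s\<close>,
  which contain numbers of annuli proportional to \<open>m\<close>.
\<close>

definition cutoff :: "real \<Rightarrow> real" where
  "cutoff t = flat 0 (t - 1) * flat 0 (64 - t)"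

text \<open>
  The derivative of \<open>cutoff\<close>, since the derivative of \<open>flat 0\<close> is \<open>flat 2\<close>.
\<close>

definition cutoff' :: "real \<Rightarrow> real" where
  "cutoff' t = flat 2 (t - 1) * flat 0 (64 - t) - flat 0 (t - 1) * flat 2 (64 - t)"

lemma cutoff_has_derivative: "(cutoff has_real_derivative cutoff' t) (at t)"
  unfolding cutoff_def[abs_def] cutoff'_def
  by (auto intro!: derivative_eq_intros DERIV_chain2[OF flat_has_derivative]
      simp: numeral_2_eq_2)

lemma C_diff_on_cutoff: "C_diff_on k UNIV cutoff"
  unfolding cutoff_def[abs_def] diff_conv_add_uminus
  by (intro C_diff_on_mult C_diff_on_compose_real[OF _ _ _ _ C_diff_on_flat] C_diff_on_add
      C_diff_on_const C_diff_on_linear bounded_linear_minus bounded_linear_ident) auto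

lemma cutoff_support: "t \<notin> {1<..<64} \<Longrightarrow> cutoff t = 0" "t \<notin> {1<..<64} \<Longrightarrow> cutoff' t = 0"
  by (auto simp: cutoff_def cutoff'_def flat_eq_0)

lemma cutoff_lower_bound: "\<exists>\<delta>>0. \<forall>t\<in>{4..16}. \<delta> \<le> cutoff t"
proof -
  obtain t0 where "t0 \<in> {4..16}" "\<forall>t\<in>{4..16}. cutoff t0 \<le> cutoff t"
  proof -
    have "continuous_on {4..16} cutoff"
      unfolding cutoff_def[abs_def] by (intro continuous_intros)
    then show ?thesis
      using continuous_attains_inf[of "{4..16}" cutoff] that by auto
  qed
  moreover have "0 < cutoff t0"
    using \<open>t0 \<in> _\<close> by (auto simp: cutoff_def intro!: mult_pos_pos flat_pos)
  ultimately show ?thesis by blast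
qed

lemma cutoff_derivative_bound: "\<exists>M. \<forall>t. \<bar>t * cutoff' t\<bar> \<le> M"
proof -
  have "bounded ((\<lambda>t. t * cutoff' t) ` {1..64})"
    unfolding cutoff'_def
    by (intro compact_imp_bounded compact_continuous_image continuous_intros) auto
  then obtain M where "\<forall>t\<in>{1..64}. \<bar>t * cutoff' t\<bar> \<le> M"
    unfolding bounded_iff by auto
  then have "\<bar>t * cutoff' t\<bar> \<le> max M 0" for t
    using cutoff_support(2)[of t] by (cases "t \<in> {1..64}") (force simp: le_max_iff_disj)+
  then show ?thesis by blast
qed

definition profile :: "real \<Rightarrow> nat \<Rightarrow> real \<Rightarrow> real" where
  "profile c m s = s powr (- c / 2) * cutoff (s powr (1 / real m))"

text \<open>
  The function $|x'|^{-c}$, which is annihilated by $E + c$, cut off in $|x'|$ slowly on a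
  logarithmic scale, and in the remaining coordinates by a fixed factor on which \<open>E\<close> does not act.
\<close>

definition near_minimizer :: "'n::finite set \<Rightarrow> real \<Rightarrow> nat \<Rightarrow> real ^ 'n \<Rightarrow> complex" where
  "near_minimizer S c m x =
     of_real (profile c m (sq_norm_on S x) * flat 0 (1 - sq_norm_on (- S) x))"

lemma powr_inverse_power: "0 < m \<Longrightarrow> 0 \<le> b \<Longrightarrow> (b ^ m) powr (1 / real m) = (b::real)"
  by (cases "b = 0") (auto simp: powr_powr simp flip: powr_realpow)

lemma profile_support:
  assumes "0 < m" "0 \<le> s" "profile c m s \<noteq> 0"
  shows "1 \<le> s" "s \<le> 64 ^ m"
proof -
  have t: "1 < s powr (1 / real m)" "s powr (1 / real m) < 64"
    using assms(3) cutoff_support(1)[of "s powr (1 / real m)"] by (auto simp: profile_def)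
  then have "s > 0" using assms(2) by (cases "s = 0") auto
  show "1 \<le> s"
    using t(1) \<open>s > 0\<close> powr_le_one_le[of s] powr_mono2[of "1 / real m" s 1] by force
  have "(64 ^ m) powr (1 / real m) = (64::real)"
    using assms(1) by (intro powr_inverse_power) auto
  then show "s \<le> 64 ^ m"
    using t(2) powr_mono2[of "1 / real m" "64 ^ m" s] by force
qed

lemma C_diff_on_sq_norm_on: "C_diff_on k UNIV (sq_norm_on S)"
  unfolding sq_norm_on_def[abs_def] power2_eq_square
  by (intro C_diff_on_sum C_diff_on_mult C_diff_on_linear bounded_linear_vec_nth open_UNIV)

lemma near_minimizer_support:
  assumes "0 < m" "near_minimizer S c m x \<noteq> 0"
  shows "x \<in> slab S 1 (64 ^ m)"
  using assms(2) profile_support[OF assms(1) sq_norm_on_nonneg, of c S x]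
    flat_eq_0[of "1 - sq_norm_on (- S) x" 0]
  by (force simp: near_minimizer_def slab_def)

text \<open>
  Where $x' \neq 0$ all factors are smooth; where $|x'| < 1$ the function is zero.
\<close>

lemma smooth_near_minimizer:
  assumes "0 < m"
  shows "smooth (near_minimizer S c m)"
  unfolding smooth_def C_diff_iff_C_diff_on_UNIV
proof
  fix k
  let ?U = "{x. 0 < sq_norm_on S x}" and ?V = "{x. sq_norm_on S x < 1}"
  have U: "open ?U" and V: "open ?V"
    by (intro open_Collect_less continuous_intros)+
  have s: "C_diff_on k ?U (sq_norm_on S')" for S'
    by (rule C_diff_on_subset[OF C_diff_on_sq_norm_on]) simp
  have powr: "C_diff_on k ?U (\<lambda>x. sq_norm_on S x powr a)" for a
    by (rule C_diff_on_compose_real[OF U _ _ s C_diff_on_powr]) auto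
  have "C_diff_on k ?U (\<lambda>x. cutoff (sq_norm_on S x powr (1 / real m)))"
    by (rule C_diff_on_compose_real[OF U _ _ powr C_diff_on_cutoff]) auto
  moreover have "C_diff_on k ?U (\<lambda>x. 1 + (- sq_norm_on (- S) x))"
    by (intro C_diff_on_add[OF U] C_diff_on_const[OF U] s
        C_diff_on_linear_compose[OF U bounded_linear_minus[OF bounded_linear_ident]])
  then have "C_diff_on k ?U (\<lambda>x. flat 0 (1 + (- sq_norm_on (- S) x)))"
    by (intro C_diff_on_compose_real[OF U open_UNIV _ _ C_diff_on_flat]) auto
  ultimately have "C_diff_on k ?U (near_minimizer S c m)"
    unfolding near_minimizer_def[abs_def] profile_def diff_conv_add_uminus
    by (intro C_diff_on_linear_compose[OF U bounded_linear_of_real] C_diff_on_mult[OF U] powr)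
  moreover have "near_minimizer S c m x = 0" if "x \<in> ?V" for x
    using near_minimizer_support[OF assms, of S c x] that by (auto simp: slab_def)
  then have "C_diff_on k ?V (near_minimizer S c m)"
    using C_diff_on_cong[OF V, of "near_minimizer S c m" "\<lambda>_. 0"] C_diff_on_const[OF V] by blast
  moreover have "?U \<union> ?V = UNIV" by auto
  ultimately show "C_diff_on k UNIV (near_minimizer S c m)"
    using C_diff_on_Un[OF U V] by metis
qed

lemma near_minimizer_test_function:
  assumes "0 < m"
  shows "near_minimizer (stratum w 1) c m \<in> test_functions w"
proof -
  let ?f = "near_minimizer (stratum w 1) c m" and ?K = "slab (stratum w 1) 1 (64 ^ m)"
  have sub: "{x. ?f x \<noteq> 0} \<subseteq> ?K"
    using near_minimizer_support[OF assms] by auto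
  then have "closure {x. ?f x \<noteq> 0} \<subseteq> ?K"
    by (intro closure_minimal closed_slab)
  moreover have "compact (closure {x. ?f x \<noteq> 0})"
    unfolding compact_closure by (rule bounded_subset[OF compact_imp_bounded[OF compact_slab] sub])
  moreover have "?K \<subseteq> {x. \<exists>k\<in>stratum w 1. x $ k \<noteq> 0}"
    using sq_norm_on_eq_0_iff[of "stratum w 1"] by (force simp: slab_def)
  ultimately show ?thesis
    using smooth_near_minimizer[OF assms] unfolding test_functions_def by blast
qed

text \<open>
  The exponent is chosen so that squaring the profile and dividing by $|x'|^2$ gives
  the scale invariant density $|x'|^{-N}$.
\<close>

lemma powr_profile_weight:
  assumes "s > 0" "c = (real n - 2) / 2"
  shows "s powr - (real n / 2) = (s powr - (c / 2))\<^sup>2 / s"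
proof -
  have "(s powr - (c / 2))\<^sup>2 / s = s powr - (c / 2) * s powr - (c / 2) / s powr 1"
    using assms(1) by (simp add: power2_eq_square)
  also have "\<dots> = s powr (- (c / 2) + - (c / 2) - 1)"
    by (simp only: powr_add powr_diff)
  also have "- (c / 2) + - (c / 2) - 1 = - (real n / 2)"
    unfolding assms(2) by (simp add: field_simps)
  finally show ?thesis by simp
qed

text \<open>
  With $t = s^{1/m}$ we have $E s = 2s$ and $E t = (2/m) t$. Hence \<open>E\<close> turns $s^{-c/2}$ into
  $-c s^{-c/2}$, which cancels against the term \<open>c f\<close>, and the cutoff contributes
  $(2/m)\, t\, \mathrm{cutoff}'(t)$.
\<close>

lemma near_minimizer_radial_defect:
  fixes S :: "'n::finite set"
  assumes m: "0 < m" and c: "c = (real (card S) - 2) / 2"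
  defines "f \<equiv> near_minimizer S c m"
  shows "(cmod (frechet_derivative f (at x) (layer_projection S x) + c *\<^sub>R f x))\<^sup>2 / sq_norm_on S x =
    4 / (real m)\<^sup>2 * (sq_norm_on S x powr (1 / real m) * cutoff' (sq_norm_on S x powr (1 / real m)))\<^sup>2 * annulus_weight S x"
proof (cases "sq_norm_on S x = 0")
  case True
  then show ?thesis by (simp add: annulus_weight_def)
next
  case False
  define s where "s = sq_norm_on S x"
  define t where "t = s powr (1 / real m)"
  define e where "e x = flat 0 (1 - sq_norm_on (- S) x)" for x :: "real ^ 'n"
  have s: "s > 0" using False sq_norm_on_nonneg[of S x] by (simp add: s_def)
  let ?E = "layer_projection S x"
  define p' where "p' = - c / 2 * s powr (- c / 2 - 1) * cutoff t + s powr (- c / 2) * (cutoff' t * (1 / real m * s powr (1 / real m - 1)))"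
  have "(profile c m has_real_derivative p') (at s)"
    unfolding profile_def[abs_def] p'_def t_def using s
    by (auto intro!: derivative_eq_intros DERIV_chain2[OF cutoff_has_derivative])
  then have "((\<lambda>x. profile c m (sq_norm_on S x)) has_derivative
      (\<lambda>v. p' * (\<Sum>k\<in>S. 2 * x $ k * v $ k))) (at x)"
    using has_derivative_compose[OF sq_norm_on_has_derivative]
    by (simp add: s_def has_field_derivative_def)
  moreover have "(e has_derivative
      (\<lambda>v. (flat 2 (1 - sq_norm_on (- S) x)) * - (\<Sum>k\<in>- S. 2 * x $ k * v $ k))) (at x)"
  proof -
    have "((\<lambda>x. 1 - sq_norm_on (- S) x) has_derivative (\<lambda>v. 0 - (\<Sum>k\<in>- S. 2 * x $ k * v $ k))) (at x)"
      by (intro has_derivative_diff has_derivative_const sq_norm_on_has_derivative)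
    from has_derivative_compose[OF this flat_has_derivative[of 0, unfolded has_field_derivative_def]]
    show ?thesis by (simp add: e_def[abs_def] numeral_2_eq_2)
  qed
  ultimately have "((\<lambda>x. profile c m (sq_norm_on S x) * e x) has_derivative
      (\<lambda>v. profile c m s * (flat 2 (1 - sq_norm_on (- S) x) * - (\<Sum>k\<in>- S. 2 * x $ k * v $ k)) +
        p' * (\<Sum>k\<in>S. 2 * x $ k * v $ k) * e x)) (at x)"
    unfolding s_def by (rule has_derivative_mult)
  then have "(f has_derivative
      (\<lambda>v. of_real (profile c m s * (flat 2 (1 - sq_norm_on (- S) x) * - (\<Sum>k\<in>- S. 2 * x $ k * v $ k)) +
        p' * (\<Sum>k\<in>S. 2 * x $ k * v $ k) * e x))) (at x)"
    unfolding f_def near_minimizer_def[abs_def] e_def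
    by (rule bounded_linear.has_derivative[OF bounded_linear_of_real])
  note der = frechet_derivative_at[OF this, symmetric]
  have off: "(\<Sum>k\<in>- S. 2 * x $ k * ?E $ k) = 0"
    by (intro sum.neutral) (simp add: layer_projection_def)
  have on: "(\<Sum>k\<in>S. 2 * x $ k * ?E $ k) = 2 * s"
    by (simp add: layer_projection_def s_def sq_norm_on_def sum_distrib_left power2_eq_square mult.assoc)
  have "frechet_derivative f (at x) ?E = of_real (2 * s * p' * e x)"
    unfolding der off on by simp
  then have eq: "frechet_derivative f (at x) ?E + c *\<^sub>R f x = of_real ((2 * s * p' + c * profile c m s) * e x)"
    by (simp add: f_def near_minimizer_def s_def[symmetric] e_def[symmetric] scaleR_conv_of_real algebra_simps)
  have "2 * s * p' + c * profile c m s = 2 / real m * s powr (- c / 2) * (t * cutoff' t)"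
  proof -
    have "s * s powr (a - 1) = s powr a" for a
      using s by (simp add: powr_diff)
    note this[of "- c / 2"] this[of "1 / real m"]
    moreover have "2 * s * p' = - c * (s * s powr (- c / 2 - 1)) * cutoff t +
        2 / real m * s powr (- c / 2) * ((s * s powr (1 / real m - 1)) * cutoff' t)"
      by (simp add: p'_def algebra_simps)
    ultimately show ?thesis by (simp only: profile_def t_def[symmetric])
  qed
  then have "(cmod (frechet_derivative f (at x) ?E + c *\<^sub>R f x))\<^sup>2 / s =
      (2 / real m * s powr (- c / 2) * (t * cutoff' t) * e x)\<^sup>2 / s"
    by (simp only: eq norm_of_real power2_abs)
  then have "(cmod (frechet_derivative f (at x) ?E + c *\<^sub>R f x))\<^sup>2 / s =
      4 / (real m)\<^sup>2 * (t * cutoff' t)\<^sup>2 * (((s powr (- c / 2))\<^sup>2 / s) * (e x)\<^sup>2)"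
    by (simp add: power_mult_distrib power_divide)
  moreover have "(s powr (- c / 2))\<^sup>2 / s = s powr (- (real (card S) / 2))"
    using powr_profile_weight[OF s c] by simp
  ultimately show ?thesis
    unfolding annulus_weight_def e_def[symmetric] s_def[symmetric] t_def[symmetric] by (simp only: mult.assoc)
qed

text \<open>
  The derivative of the cutoff is supported in $1 \le |x'|^2 \le 4^{3m}$, which is covered by
  \<open>3 * m + 1\<close> annuli.
\<close>

lemma near_minimizer_defect_le:
  fixes S :: "'n::finite set"
  assumes m: "0 < m" and c: "c = (real (card S) - 2) / 2"
    and M: "\<And>t. \<bar>t * cutoff' t\<bar> \<le> M"
  defines "f \<equiv> near_minimizer S c m"
  shows "(LINT x|lborel. (cmod (frechet_derivative f (at x) (layer_projection S x) + c *\<^sub>R f x))\<^sup>2 / sq_norm_on S x)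
    \<le> 4 * M\<^sup>2 / (real m)\<^sup>2 * ((3 * real m + 1) * annulus_mass S 1 4)"
proof -
  let ?T = "\<lambda>x. sq_norm_on S x powr (1 / real m)"
  let ?g = "\<lambda>x. 4 / (real m)\<^sup>2 * (?T x * cutoff' (?T x))\<^sup>2 * annulus_weight S x"
  let ?b = "(4::real) ^ (3 * m + 1)"
  let ?h = "\<lambda>x. 4 * M\<^sup>2 / (real m)\<^sup>2 * (indicator {x. 1 \<le> sq_norm_on S x \<and> sq_norm_on S x < ?b} x * annulus_weight S x)"
  have "(LINT x|lborel. ?g x) \<le> (LINT x|lborel. ?h x)"
  proof (rule integral_mono')
    show "integrable lborel ?h"
      by (intro integrable_mult_right integrable_annulus) simp
    show "0 \<le> ?h x" for x by (simp add: annulus_weight_nonneg)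
    show "?g x \<le> ?h x" for x
    proof (cases "1 < ?T x \<and> ?T x < 64")
      case True
      have s: "sq_norm_on S x > 0"
        using True sq_norm_on_nonneg[of S x] by (cases "sq_norm_on S x = 0") auto
      have "1 \<le> sq_norm_on S x"
        using True s powr_mono2[of "1 / real m" "sq_norm_on S x" 1] by force
      moreover have "sq_norm_on S x < ?b"
      proof (rule ccontr)
        assume "\<not> sq_norm_on S x < ?b"
        then have "4 * 64 ^ m \<le> sq_norm_on S x"
          by (simp add: power_mult)
        moreover have "(0::real) \<le> 64 ^ m" by simp
        ultimately have "64 ^ m \<le> sq_norm_on S x" by linarith
        then have "(64 ^ m) powr (1 / real m) \<le> ?T x"
          by (intro powr_mono2) auto
        then show False using True powr_inverse_power[OF m, of 64] by simp
      qed
      moreover have "(?T x * cutoff' (?T x))\<^sup>2 \<le> M\<^sup>2"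
        using M[of "?T x"] abs_le_square_iff[of "?T x * cutoff' (?T x)" M] by force
      then have "4 / (real m)\<^sup>2 * (?T x * cutoff' (?T x))\<^sup>2 * annulus_weight S x \<le> 4 / (real m)\<^sup>2 * M\<^sup>2 * annulus_weight S x"
        by (intro mult_right_mono mult_left_mono annulus_weight_nonneg) auto
      ultimately show ?thesis by simp
    next
      case False
      then have "cutoff' (?T x) = 0" by (intro cutoff_support) auto
      then show ?thesis by (simp add: annulus_weight_nonneg)
    qed
  qed
  also have "\<dots> = 4 * M\<^sup>2 / (real m)\<^sup>2 * annulus_mass S (4 ^ 0) (4 ^ (0 + (3 * m + 1)))"
    by (simp add: annulus_mass_def)
  also have "\<dots> = 4 * M\<^sup>2 / (real m)\<^sup>2 * ((3 * real m + 1) * annulus_mass S 1 4)"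
    by (subst annulus_mass_powers) simp
  finally show ?thesis
    unfolding f_def near_minimizer_radial_defect[OF m c] .
qed

text \<open>
  On the \<open>m\<close> annuli with $4^m \le |x'|^2 < 4^{2m}$ the cutoff is bounded below.
\<close>

lemma near_minimizer_norm_ge:
  fixes S :: "'n::finite set"
  assumes m: "0 < m" and c: "c = (real (card S) - 2) / 2"
    and \<delta>: "0 < \<delta>" "\<And>t. t \<in> {4..16} \<Longrightarrow> \<delta> \<le> cutoff t"
  shows "\<delta>\<^sup>2 * (real m * annulus_mass S 1 4) \<le> (LINT x|lborel. (cmod (near_minimizer S c m x))\<^sup>2 / sq_norm_on S x)"
proof -
  let ?T = "\<lambda>x. sq_norm_on S x powr (1 / real m)"
  let ?h = "\<lambda>x. \<delta>\<^sup>2 * (indicator {x. 4 ^ m \<le> sq_norm_on S x \<and> sq_norm_on S x < 4 ^ (m + m)} x * annulus_weight S x)"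
  let ?g = "\<lambda>x. (cmod (near_minimizer S c m x))\<^sup>2 / sq_norm_on S x"
  have g: "?g x = (cutoff (?T x))\<^sup>2 * annulus_weight S x" for x
  proof (cases "sq_norm_on S x = 0")
    case False
    then have s: "sq_norm_on S x > 0" using sq_norm_on_nonneg[of S x] by simp
    define s where "s = sq_norm_on S x"
    have "s powr - (real (card S) / 2) = (s powr - (c / 2))\<^sup>2 / s"
      by (rule powr_profile_weight) (use s c in \<open>auto simp: s_def\<close>)
    then show ?thesis
      by (simp add: near_minimizer_def profile_def annulus_weight_def norm_mult power_mult_distrib
          s_def[symmetric])
  qed (simp add: annulus_weight_def)
  have "\<delta>\<^sup>2 * annulus_mass S (4 ^ m) (4 ^ (m + m)) = (LINT x|lborel. ?h x)"
    by (simp add: annulus_mass_def)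
  also have "\<dots> \<le> (LINT x|lborel. ?g x)"
  proof (rule integral_mono')
    show "integrable lborel ?g"
    proof (rule integrable_weighted[OF compact_slab])
      show "continuous_on (slab S 1 (64 ^ m)) (near_minimizer S c m)"
        by (rule smooth_continuous[OF smooth_near_minimizer[OF m]])
      show "near_minimizer S c m x = 0" if "x \<notin> slab S 1 (64 ^ m)" for x
        using near_minimizer_support[OF m] that by blast
    qed (auto simp: slab_def)
    show "0 \<le> ?g x" for x by (simp add: sq_norm_on_nonneg)
    show "?h x \<le> ?g x" for x
    proof (cases "4 ^ m \<le> sq_norm_on S x \<and> sq_norm_on S x < 4 ^ (m + m)")
      case True
      have "(4 ^ m) powr (1 / real m) \<le> ?T x" "?T x \<le> (16 ^ m) powr (1 / real m)"
        using True by (intro powr_mono2; simp add: sq_norm_on_nonneg power_add flip: power_mult_distrib)+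
      then have "\<delta> \<le> cutoff (?T x)"
        by (intro \<delta>(2)) (simp add: powr_inverse_power m)
      then have "\<delta>\<^sup>2 \<le> (cutoff (?T x))\<^sup>2"
        using \<delta>(1) by (intro power_mono) auto
      then show ?thesis
        unfolding g using True by (simp add: mult_right_mono annulus_weight_nonneg)
    next
      case False
      then show ?thesis unfolding g by (auto simp: annulus_weight_nonneg)
    qed
  qed
  finally show ?thesis by (simp only: annulus_mass_powers)
qed

text \<open>
  If $C > c$, the blow-up inequality for the near minimizers, whose defect is at most a multiple of
  $1/m$ and whose norm squared is at least a multiple of \<open>m\<close>, bounds $(C^2 - c^2)\, m^2$
  independently of \<open>m\<close>.
\<close>

lemma stratified_hardy_sharp:
  fixes mul :: "real ^ 'n \<Rightarrow> real ^ 'n \<Rightarrow> real ^ 'n::finite"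
  assumes sg: "stratified_group mul w" and hf: "horizontal_frame mul w X"
    and N: "card (stratum w 1) \<ge> 3"
    and C: "\<And>f. f \<in> test_functions w \<Longrightarrow>
        C * L2_norm (\<lambda>x. f x / of_real (horizontal_norm w x))
        \<le> L2_norm (\<lambda>x. horizontal_radial w X f x / of_real (horizontal_norm w x))"
  shows "C \<le> (real (card (stratum w 1)) - 2) / 2"
proof (rule ccontr)
  define c where "c = (real (card (stratum w 1)) - 2) / 2"
  assume "\<not> C \<le> (real (card (stratum w 1)) - 2) / 2"
  then have "c < C" by (simp add: c_def)
  moreover have "0 \<le> c" using N by (simp add: c_def)
  ultimately have "C \<ge> 0" and gap: "0 < C\<^sup>2 - c\<^sup>2"
    by (auto intro: power_strict_mono)
  let ?S = "stratum w 1"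
  obtain \<delta> where \<delta>: "\<delta> > 0" "\<And>t. t \<in> {4..16} \<Longrightarrow> \<delta> \<le> cutoff t"
    using cutoff_lower_bound by blast
  obtain M where M: "\<And>t. \<bar>t * cutoff' t\<bar> \<le> M"
    using cutoff_derivative_bound by blast
  have "?S \<noteq> {}" using N by (metis card.empty not_numeral_le_zero)
  then have mass: "0 < annulus_mass ?S 1 4" by (rule annulus_mass_pos)
  have bound: "(C\<^sup>2 - c\<^sup>2) * \<delta>\<^sup>2 * (real m)\<^sup>2 \<le> 16 * M\<^sup>2" if m: "0 < m" for m :: nat
  proof -
    have "(C\<^sup>2 - c\<^sup>2) * (\<delta>\<^sup>2 * (real m * annulus_mass ?S 1 4)) \<le>
        (C\<^sup>2 - c\<^sup>2) * (LINT x|lborel. (cmod (near_minimizer ?S c m x))\<^sup>2 / sq_norm_on ?S x)"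
      using gap by (intro mult_left_mono near_minimizer_norm_ge[OF m c_def \<delta>]) auto
    also have "\<dots> \<le> 4 * M\<^sup>2 / (real m)\<^sup>2 * ((3 * real m + 1) * annulus_mass ?S 1 4)"
      using blow_up_inequality[OF sg hf \<open>C \<ge> 0\<close> C near_minimizer_test_function[OF m]]
        near_minimizer_defect_le[OF m c_def M]
      unfolding c_def[symmetric] by (meson order_trans)
    finally have "(C\<^sup>2 - c\<^sup>2) * \<delta>\<^sup>2 * real m * annulus_mass ?S 1 4 \<le> 4 * M\<^sup>2 / (real m)\<^sup>2 * (3 * real m + 1) * annulus_mass ?S 1 4"
      by (simp only: mult.assoc)
    then have "(C\<^sup>2 - c\<^sup>2) * \<delta>\<^sup>2 * real m \<le> 4 * M\<^sup>2 / (real m)\<^sup>2 * (3 * real m + 1)"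
      using mass by (rule mult_right_le_imp_le)
    also have "\<dots> \<le> 4 * M\<^sup>2 / (real m)\<^sup>2 * (4 * real m)"
      using m by (intro mult_left_mono) auto
    also have "\<dots> = 16 * M\<^sup>2 / (real m)\<^sup>2 * real m"
      by simp
    finally have "(C\<^sup>2 - c\<^sup>2) * \<delta>\<^sup>2 \<le> 16 * M\<^sup>2 / (real m)\<^sup>2"
      using m by (simp add: mult_right_le_imp_le)
    then show ?thesis using m by (simp add: field_simps)
  qed
  have pos: "0 < (C\<^sup>2 - c\<^sup>2) * \<delta>\<^sup>2"
    using gap \<delta>(1) by simp
  obtain m :: nat where m: "16 * M\<^sup>2 < m * ((C\<^sup>2 - c\<^sup>2) * \<delta>\<^sup>2)"
    using reals_Archimedean3[OF pos] by blast
  then have "m > 0"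
    using zero_le_power2[of M] by (cases m) (auto simp: not_less)
  then have "real m * ((C\<^sup>2 - c\<^sup>2) * \<delta>\<^sup>2) \<le> (real m)\<^sup>2 * ((C\<^sup>2 - c\<^sup>2) * \<delta>\<^sup>2)"
    using pos by (intro mult_right_mono) (auto simp: power2_eq_square)
  then show False
    using m bound[OF \<open>m > 0\<close>] by (simp add: mult.commute)
qed

theorem theorem4p5:
  fixes mul :: "real ^ 'n \<Rightarrow> real ^ 'n \<Rightarrow> real ^ 'n"
    and w :: "'n::finite \<Rightarrow> nat"
    and X :: "'n \<Rightarrow> real ^ 'n \<Rightarrow> real ^ 'n"
    and N :: nat
  assumes "stratified_group mul w"
    and "horizontal_frame mul w X"
    and "N = card (stratum w 1)"
    and "N \<ge> 3"
  shows "(\<forall>f \<in> test_functions w.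
            L2_norm (\<lambda>x. horizontal_radial w X f x / of_real (horizontal_norm w x))
              \<ge> (real N - 2) / 2 * L2_norm (\<lambda>x. f x / of_real (horizontal_norm w x)))
       \<and> (\<forall>C::real.
            (\<forall>f \<in> test_functions w.
               L2_norm (\<lambda>x. horizontal_radial w X f x / of_real (horizontal_norm w x))
                 \<ge> C * L2_norm (\<lambda>x. f x / of_real (horizontal_norm w x)))
            \<longrightarrow> C \<le> (real N - 2) / 2)"
  using stratified_hardy_inequality[OF assms(1,2)] stratified_hardy_sharp[OF assms(1,2)] assms(4)
  unfolding assms(3) by blast

end
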